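(* Let $V$ be a group-like set and let $\mu$ be a good measure on $2^{\mathbb{N}}$ whose clopen values set equals $V$. Let $H=\{h^*(\mu): h\in\mathrm{Homeo}(2^{\mathbb{N}})\}$ be the conjugacy class of $\mu$. Then: (a) The strong topology on $\mathrm{Full}(V)$ is Polish and stronger than the weak$^*$ topology on $\mathrm{Full}(V)$. (b) In the weak$^*$ topology, $\mathrm{Full}(V)$ is an $F_{\sigma\delta}$ subset of $\mathrm{Prob}(2^{\mathbb{N}})$. (c) In the weak$^*$ topology, $H$ is a dense $F_{\sigma\delta}$ subset of $\mathrm{Full}(V)$. (d) In the strong topology, $H$ is the unique dense $G_\delta$ conjugacy class in $\mathrm{Full}(V)$.
   Context: All measures are Borel probability measures; $2^{\mathbb{N}}$ is the Cantor space. A measure is full if it is positive on every nonempty open set; the clopen values set of $\nu$ is $\{\nu(U):U\text{ clopen}\}$. A full measure $\mu$ on $2^{\mathbb{N}}$ is good if whenever $U,W$ are clopen with $\mu(U)<\mu(W)$, there is a clopen $W'\subseteq W$ with $\mu(W')=\mu(U)$. A set $V$ is group-like if it is countably infinite, $\{0,1\}\subseteq V\subseteq[0,1]$, and $V+\mathbb{Z}$ is an additive subgroup of $\mathbb{R}$. For a homeomorphism $h$, $h^*(\mu)(B)=\mu(h^{-1}(B))$ for Borel $B$. $\mathrm{Prob}(2^{\mathbb{N}})$ is the set of all Borel probability measures on $2^{\mathbb{N}}$ with the weak$^*$ topology (equivalently, $\mu_n\to\mu$ iff $\mu_n(U)\to\mu(U)$ for all clopen $U$). $\mathrm{Full}(V)$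 is the set of all full measures on $2^{\mathbb{N}}$ whose clopen values set is contained in $V$. The weak$^*$ topology on $\mathrm{Full}(V)$ is the subspace topology from $\mathrm{Prob}(2^{\mathbb{N}})$. The strong topology on $\mathrm{Full}(V)$ is the topology of pointwise convergence on clopen sets with respect to the discrete topology on $V$ (so $\mu_n\to\mu$ iff for each clopen $U$, $\mu_n(U)=\mu(U)$ for all large $n$). $\mathrm{Homeo}(2^{\mathbb{N}})$ acts on $\mathrm{Full}(V)$ by $(h,\nu)\mapsto h^*(\nu)$; conjugacy classes in $\mathrm{Full}(V)$ are the orbits of this action. *)

theory Defs
  imports "HOL-Probability.Probability"
begin

text \<open>The type class instances equip \<^typ>\<open>nat \<Rightarrow> bool\<close> with the product topology
  of discrete two-point spaces.\<close>

type_synonym cantor = "nat \<Rightarrow> bool"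

definition clopen :: "cantor set \<Rightarrow> bool" where
  "clopen U \<longleftrightarrow> open U \<and> closed U"

definition Prob :: "cantor measure set" where
  "Prob = {M. prob_space M \<and> sets M = sets borel}"

definition full :: "cantor measure \<Rightarrow> bool" where
  "full M \<longleftrightarrow> (\<forall>U. open U \<and> U \<noteq> {} \<longrightarrow> measure M U > 0)"

definition clopen_values :: "cantor measure \<Rightarrow> real set" where
  "clopen_values M = {measure M U | U. clopen U}"

definition good :: "cantor measure \<Rightarrow> bool" where
  "good M \<longleftrightarrow> M \<in> Prob \<and> full M \<and>
     (\<forall>U W. clopen U \<and> clopen W \<and> measure M U < measure M W \<longrightarrow>
        (\<exists>W'. clopen W' \<and> W' \<subseteq> W \<and> measure M W' = measure M U))"

definition additive_subgroup :: "real set \<Rightarrow> bool" where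
  "additive_subgroup G \<longleftrightarrow>
     0 \<in> G \<and> (\<forall>x\<in>G. \<forall>y\<in>G. x + y \<in> G) \<and> (\<forall>x\<in>G. - x \<in> G)"

definition group_like :: "real set \<Rightarrow> bool" where
  "group_like V \<longleftrightarrow> countable V \<and> infinite V \<and> {0, 1} \<subseteq> V \<and> V \<subseteq> {0..1} \<and>
     additive_subgroup {v + z | v z. v \<in> V \<and> z \<in> \<int>}"

definition Full :: "real set \<Rightarrow> cantor measure set" where
  "Full V = {M \<in> Prob. full M \<and> clopen_values M \<subseteq> V}"

definition Homeo :: "(cantor \<Rightarrow> cantor) set" where
  "Homeo = {h. \<exists>g. homeomorphism UNIV UNIV h g}"

text \<open>The pushforward \<open>h\<^sup>*(M)\<close> is \<^term>\<open>distr M borel h\<close>.\<close>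

definition conjugacy_class :: "cantor measure \<Rightarrow> cantor measure set" where
  "conjugacy_class M = {distr M borel h | h. h \<in> Homeo}"

definition conjugacy_classes :: "real set \<Rightarrow> cantor measure set set" where
  "conjugacy_classes V = conjugacy_class ` Full V"

text \<open>The coarsest topology on \<^const>\<open>Prob\<close> making \<open>M \<mapsto> \<integral>f dM\<close> continuous for every
  continuous \<open>f :: cantor \<Rightarrow> real\<close>. The space is compact, so such \<open>f\<close> are bounded.\<close>

definition weak_star :: "cantor measure topology" where
  "weak_star = pullback_topology Prob
     (\<lambda>M. \<lambda>f\<in>{f. continuous_on UNIV f}. \<integral>x. f x \<partial>M)
     (product_topology (\<lambda>_. euclideanreal) {f :: cantor \<Rightarrow> real. continuous_on UNIV f})"

definition weak_star_Full :: "real set \<Rightarrow> cantor measure topology" where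
  "weak_star_Full V = subtopology weak_star (Full V)"

definition strong_Full :: "real set \<Rightarrow> cantor measure topology" where
  "strong_Full V = pullback_topology (Full V)
     (\<lambda>M. \<lambda>U\<in>Collect clopen. measure M U)
     (product_topology (\<lambda>_. discrete_topology V) (Collect clopen))"

definition polish_topology :: "'a topology \<Rightarrow> bool" where
  "polish_topology X \<longleftrightarrow> separable_space X \<and> completely_metrizable_space X"

text \<open>As for \<^const>\<open>gdelta_in\<close>, relativisation makes the empty intersection \<^term>\<open>topspace X\<close>.\<close>

definition fsigma_delta_in :: "'a topology \<Rightarrow> 'a set \<Rightarrow> bool" where
  "fsigma_delta_in X = (countable intersection_of fsigma_in X) relative_to topspace X"

definition dense_in :: "'a topology \<Rightarrow> 'a set \<Rightarrow> bool" where
  "dense_in X S \<longleftrightarrow> S \<subseteq> topspace X \<and> X closure_of S = topspace X"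

lemma topspace_weak_star: "topspace weak_star = Prob"
  by (auto simp: weak_star_def topspace_pullback_topology)

lemma topspace_weak_star_Full: "topspace (weak_star_Full V) = Full V"
  by (auto simp: weak_star_Full_def topspace_weak_star Full_def)

lemma topspace_strong_Full: "topspace (strong_Full V) = Full V"
  by (fastforce simp: strong_Full_def topspace_pullback_topology Full_def clopen_values_def)

end

theory Submission
  imports Defs
begin

text \<open>A measure is determined by its finitely additive restriction to the countable algebra of
  clopen sets, so \<^term>\<open>strong_Full V\<close> is a closed subspace of a countable power of the discrete
  space \<open>V\<close>. A back-and-forth argument shows that good measures with the same clopen values are
  conjugate; hence \<^term>\<open>conjugacy_class \<mu>\<close> consists of those \<open>\<nu> \<in> Full V\<close> such that, for all clopen
  \<open>W\<close> and \<open>v \<in> V\<close>, either \<open>\<nu> W \<le> v\<close> or some clopen \<open>W' \<subseteq> W\<close> has \<open>\<nu> W' = v\<close>. These conditions are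
  \<open>F\<^sub>\<sigma>\<close> in the weak-star and open in the strong topology. The same back-and-forth argument extends a
  matching of two finite clopen partitions to a homeomorphism, which gives strong density: cut the
  space into clopen pieces whose \<open>\<mu>\<close>-measures are the \<open>\<nu>\<close>-measures of the cylinders. By Baire, two
  dense \<open>G\<^sub>\<delta>\<close> classes meet.\<close>

section \<open>Clopen subsets of the Cantor space\<close>

text \<open>The alternatives for \<open>W\<close> and \<open>v\<close> are chosen for their
  topological form. Goodness compares two values of the same measure by a strict inequality.
  Replacing one of them by a constant \<open>v\<close> from the countable set \<open>V\<close>
  leaves countably many conditions, each a countable union of conditions
  \<open>\<nu> W \<le> v\<close> or \<open>\<nu> W' = v\<close>. These are closed in the weak-star
  topology, and open once values are discrete, so one formula yields both Borel classes. With
  \<open>W\<close> the whole space it also forces every \<open>v < 1\<close> in \<open>V\<close> to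
  be a clopen value of \<nu>. The obstacle to density is that \<nu> need not be good, so no matching
  by measure can carry \<mu> to it. But only finitely many values have to be reproduced: measures
  serve just to cut the space, and the homeomorphism is built from the mere pattern of which
  partition pieces a clopen set meets. This is why back and forth is stated for an abstract relation
  between clopen sets.\<close>

primrec pre :: "nat \<Rightarrow> cantor \<Rightarrow> bool list" where
  "pre 0 x = []"
| "pre (Suc n) x = x n # pre n x"

definition cyl :: "nat \<Rightarrow> cantor \<Rightarrow> cantor set" where
  "cyl n x = {y. pre n y = pre n x}"

lemma length_pre [simp]: "length (pre n x) = n"
  by (induction n) auto

lemma pre_eq_iff: "pre n x = pre n y \<longleftrightarrow> (\<forall>i<n. x i = y i)"
  by (induction n) (auto simp: less_Suc_eq)

lemma in_cyl_self [simp]: "x \<in> cyl n x"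
  by (simp add: cyl_def)

lemma cyl_eq: "y \<in> cyl n x \<Longrightarrow> cyl n y = cyl n x"
  by (auto simp: cyl_def)

lemma cyl_antimono: "m \<le> n \<Longrightarrow> cyl n x \<subseteq> cyl m x"
  by (auto simp: cyl_def pre_eq_iff)

lemma finite_cyls: "finite (range (cyl n))"
proof -
  have "range (cyl n) \<subseteq> (\<lambda>w. {y. pre n y = w}) ` {w. length w = n}"
    by (force simp: cyl_def)
  moreover have "finite {w::bool list. length w = n}"
    using finite_lists_length_eq[of "UNIV :: bool set" n] by simp
  ultimately show ?thesis
    by (meson finite_surj)
qed

lemma disjoint_cyls: "C \<in> range (cyl n) \<Longrightarrow> D \<in> range (cyl n) \<Longrightarrow> C \<noteq> D \<Longrightarrow> C \<inter> D = {}"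
  by (auto simp: cyl_def)

lemma clopen_coordinate: "clopen {x. x i = b}"
proof -
  have "continuous_on UNIV (\<lambda>x::cantor. x i)"
    by simp
  then have "open ((\<lambda>x::cantor. x i) -` {b})" "open ((\<lambda>x::cantor. x i) -` {\<not> b})"
    by (auto intro!: open_vimage Topological_Spaces.open_discrete)
  moreover have "(\<lambda>x::cantor. x i) -` {\<not> b} = - {x. x i = b}"
    by auto
  ultimately show ?thesis
    by (simp add: clopen_def closed_def vimage_def)
qed

lemma clopen_UNIV [simp]: "clopen UNIV" and clopen_empty [simp]: "clopen {}"
  by (simp_all add: clopen_def)

lemma clopen_Un [intro]: "clopen A \<Longrightarrow> clopen B \<Longrightarrow> clopen (A \<union> B)"
  and clopen_Int [intro]: "clopen A \<Longrightarrow> clopen B \<Longrightarrow> clopen (A \<inter> B)"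
  and clopen_Diff [intro]: "clopen A \<Longrightarrow> clopen B \<Longrightarrow> clopen (A - B)"
  by (auto simp: clopen_def open_Diff closed_Diff)

lemma clopen_UN: "finite I \<Longrightarrow> (\<And>i. i \<in> I \<Longrightarrow> clopen (A i)) \<Longrightarrow> clopen (\<Union>i\<in>I. A i)"
  unfolding clopen_def by (intro conjI open_UN closed_UN ballI) auto

lemma clopen_cyl [simp]: "clopen (cyl n x)"
proof (induction n)
  case (Suc n)
  have "cyl (Suc n) x = {y. y n = x n} \<inter> cyl n x"
    by (auto simp: cyl_def)
  then show ?case
    using Suc clopen_coordinate by auto
qed (simp add: cyl_def)

lemma compact_cantor: "compact (UNIV :: cantor set)"
proof -
  have "compact_space (euclidean :: bool topology)"
    unfolding compact_space_def by (intro finite_imp_compactin) auto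
  then have "compact_space (product_topology (\<lambda>_. euclidean :: bool topology) (UNIV :: nat set))"
    by (simp add: compact_space_product_topology)
  then show ?thesis
    by (simp add: euclidean_product_topology compact_space_def)
qed

lemma open_contains_cyl:
  assumes "open U" "x \<in> U"
  shows "\<exists>n. cyl n x \<subseteq> U"
proof -
  have "openin (product_topology (\<lambda>i. euclidean) UNIV) U"
    using assms(1) by (simp add: open_fun_def)
  from product_topology_open_contains_basis[OF this assms(2)]
  obtain X where X: "x \<in> (\<Pi>\<^sub>E i\<in>UNIV. X i)" "finite {i. X i \<noteq> UNIV}" "(\<Pi>\<^sub>E i\<in>UNIV. X i) \<subseteq> U"
    by auto
  then obtain n where n: "\<And>i. X i \<noteq> UNIV \<Longrightarrow> i < n"
    using finite_nat_set_iff_bounded by auto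
  have "y \<in> (\<Pi>\<^sub>E i\<in>UNIV. X i)" if "y \<in> cyl n x" for y
  proof -
    have "y i \<in> X i" for i
      using that X(1) n[of i] by (cases "X i = UNIV") (auto simp: cyl_def pre_eq_iff)
    then show ?thesis
      by auto
  qed
  then show ?thesis
    using X(3) by blast
qed

text \<open>Cylinders act as balls: compactness leaves finitely many of them, each inside a member
  of the cover, and the cylinders at the largest of their levels refine all of these.\<close>

lemma Lebesgue_number_cyl:
  assumes opn: "\<And>C. C \<in> \<C> \<Longrightarrow> open C" and cover: "\<Union>\<C> = UNIV"
  shows "\<exists>n. \<forall>x. \<exists>C\<in>\<C>. cyl n x \<subseteq> C"
proof -
  have "\<exists>n. \<exists>C\<in>\<C>. cyl n x \<subseteq> C" for x
    using assms open_contains_cyl[of _ x] by (metis UNIV_I UnionE)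
  then obtain m where m: "\<And>x. \<exists>C\<in>\<C>. cyl (m x) x \<subseteq> C"
    by metis
  have "UNIV \<subseteq> (\<Union>x\<in>UNIV. cyl (m x) x)"
    using in_cyl_self by blast
  moreover have "\<forall>x\<in>UNIV. open (cyl (m x) x)"
    using clopen_cyl clopen_def by blast
  ultimately obtain S where S: "finite S" "UNIV \<subseteq> (\<Union>x\<in>S. cyl (m x) x)"
    using compactE_image[OF compact_cantor, of UNIV "\<lambda>x. cyl (m x) x"] by auto
  define n where "n = Max (m ` S)"
  have "\<exists>C\<in>\<C>. cyl n x \<subseteq> C" for x
  proof -
    obtain z where z: "z \<in> S" "x \<in> cyl (m z) z"
      using S by blast
    then have "m z \<le> n"
      using S by (simp add: n_def)
    then have "cyl n x \<subseteq> cyl (m z) z"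
      using cyl_antimono cyl_eq[OF z(2)] by metis
    then show ?thesis
      using m[of z] by blast
  qed
  then show ?thesis
    by blast
qed

lemma clopen_depends_finite:
  assumes "clopen U"
  shows "\<exists>n. \<forall>x. cyl n x \<subseteq> U \<or> cyl n x \<inter> U = {}"
  using Lebesgue_number_cyl[of "{U, - U}"] assms by (auto simp: clopen_def open_Compl disjoint_eq_subset_Compl)

lemma cyl_family_depends_finite:
  assumes "finite \<U>" "\<And>U. U \<in> \<U> \<Longrightarrow> clopen U"
  shows "\<exists>n. \<forall>U\<in>\<U>. \<forall>x. cyl n x \<subseteq> U \<or> cyl n x \<inter> U = {}"
proof -
  obtain m where m: "\<And>U x. U \<in> \<U> \<Longrightarrow> cyl (m U) x \<subseteq> U \<or> cyl (m U) x \<inter> U = {}"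
    using assms clopen_depends_finite by metis
  have "cyl (Max (m ` \<U>)) x \<subseteq> U \<or> cyl (Max (m ` \<U>)) x \<inter> U = {}" if "U \<in> \<U>" for U x
  proof -
    have "cyl (Max (m ` \<U>)) x \<subseteq> cyl (m U) x"
      using assms that by (intro cyl_antimono) auto
    then show ?thesis
      using m[OF that, of x] by blast
  qed
  then show ?thesis
    by blast
qed

lemma eq_Union_cyls:
  assumes "\<forall>x. cyl n x \<subseteq> U \<or> cyl n x \<inter> U = {}"
  shows "U = \<Union> (cyl n ` U)"
proof -
  have "cyl n x \<subseteq> U" if "x \<in> U" for x
    using assms in_cyl_self[of x n] that by blast
  then show ?thesis
    by force
qed

lemma countable_clopen: "countable (Collect clopen)"
proof -
  have "countable (\<Union>n. range (cyl n))"
    by (simp add: countable_finite finite_cyls)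
  then have "countable (Union ` {F. finite F \<and> F \<subseteq> (\<Union>n. range (cyl n))})"
    by (intro countable_image countable_Collect_finite_subset)
  moreover have "Collect clopen \<subseteq> Union ` {F. finite F \<and> F \<subseteq> (\<Union>n. range (cyl n))}"
  proof
    fix U assume "U \<in> Collect clopen"
    then obtain n where "\<forall>x. cyl n x \<subseteq> U \<or> cyl n x \<inter> U = {}"
      using clopen_depends_finite by blast
    then have "U = \<Union> (cyl n ` U)"
      by (rule eq_Union_cyls)
    moreover have "finite (cyl n ` U)"
      by (rule finite_subset[OF _ finite_cyls[of n]]) blast
    ultimately show "U \<in> Union ` {F. finite F \<and> F \<subseteq> (\<Union>n. range (cyl n))}"
      by blast
  qed
  ultimately show ?thesis
    by (rule countable_subset[rotated])
qed

text \<open>Compactness in the form used twice below: an infinite branch of nonempty nodes contains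
  a point, and finitely additive functions on clopen sets are continuous at the empty set.\<close>

lemma closed_decseq_empty:
  fixes A :: "nat \<Rightarrow> cantor set"
  assumes "\<And>i. closed (A i)" "decseq A" "(\<Inter>i. A i) = {}"
  shows "\<exists>i. A i = {}"
proof (rule ccontr)
  assume non: "\<not> ?thesis"
  have "UNIV \<inter> (\<Inter>i\<in>UNIV. A i) \<noteq> {}"
  proof (rule compact_imp_fip_image[OF compact_cantor])
    fix I :: "nat set" assume I: "finite I" "I \<subseteq> UNIV"
    have "A (Max (insert 0 I)) \<subseteq> A i" if "i \<in> I" for i
      using I that assms(2) by (auto simp: decseq_def)
    then show "UNIV \<inter> (\<Inter>i\<in>I. A i) \<noteq> {}"
      using non by blast
  qed (rule assms)
  then show False
    using assms by simp
qed

text \<open>One set has to split all pieces at once. Choose \<open>n\<close> so that every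
  \<open>B i\<close> depends only on coordinates below \<open>n\<close>; coordinate \<open>n\<close>
  can then be changed freely inside each piece, and it defines the split.\<close>

lemma proper_clopen_split:
  assumes "\<And>i. i \<in> I \<Longrightarrow> clopen (B i)" "finite I"
  shows "\<exists>C. clopen C \<and> (\<forall>i\<in>I. B i \<noteq> {} \<longrightarrow> B i \<inter> C \<noteq> {} \<and> B i - C \<noteq> {})"
proof -
  obtain n where n: "\<forall>U\<in>B`I. \<forall>x. cyl n x \<subseteq> U \<or> cyl n x \<inter> U = {}"
    using cyl_family_depends_finite[of "B ` I"] assms by auto
  have "B i \<inter> {x. x n = True} \<noteq> {} \<and> B i - {x. x n = True} \<noteq> {}" if i: "i \<in> I" "B i \<noteq> {}" for i
  proof -
    obtain x where x: "x \<in> B i"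
      using i by auto
    then have "cyl n x \<subseteq> B i"
      using n i in_cyl_self[of x n] by blast
    moreover have "x(n := b) \<in> cyl n x" for b
      by (auto simp: cyl_def pre_eq_iff)
    ultimately have "x(n := b) \<in> B i" for b
      by blast
    then have "x(n := True) \<in> B i \<inter> {x. x n = True}" "x(n := False) \<in> B i - {x. x n = True}"
      by simp_all
    then show ?thesis
      by blast
  qed
  with clopen_coordinate[of n True] show ?thesis
    by (intro exI[of _ "{x. x n = True}"] conjI ballI impI) simp_all
qed

section \<open>Back and forth\<close>

text \<open>Nodes are words read from the leaf to the root. \<open>c\<close> sends a point to its branch; the image
  depends only on which nodes are empty, so trees with the same empty nodes have matching branches.\<close>

lemma clopen_tree_coding:
  fixes L :: "bool list \<Rightarrow> cantor set"
  assumes root: "L [] = UNIV"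
    and children: "\<And>w. L (True # w) \<union> L (False # w) = L w" "\<And>w. L (True # w) \<inter> L (False # w) = {}"
    and clopen: "\<And>w. clopen (L w)"
    and fine: "\<And>U. clopen U \<Longrightarrow> \<exists>n. \<forall>w. length w = n \<longrightarrow> L w \<subseteq> U \<or> L w \<inter> U = {}"
  shows "\<exists>c c'. homeomorphism UNIV {\<sigma>. \<forall>n. L (pre n \<sigma>) \<noteq> {}} c c' \<and>
           (\<forall>x w. x \<in> L w \<longleftrightarrow> w = pre (length w) (c x))"
proof -
  \<comment> \<open>\<open>k x n\<close> is the node of depth \<open>n\<close> containing
    \<open>x\<close>, and \<open>c x n\<close> is the turn that \<open>x\<close> takes there.
    Testing the \<open>True\<close> child suffices because the two children partition the
    node.\<close>
  define k where "k x n = rec_nat [] (\<lambda>_ w. (x \<in> L (True # w)) # w) n" for x n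
  define c where "c x n \<longleftrightarrow> x \<in> L (True # k x n)" for x n
  have k_simps [simp]: "k x 0 = []" "k x (Suc n) = c x n # k x n" for x n
    by (auto simp: k_def c_def)
  have k: "k x n = pre n (c x)" for x n
    by (induction n) auto
  have mem: "x \<in> L w \<longleftrightarrow> w = pre (length w) (c x)" for x w
  proof (induction w)
    case (Cons b w)
    have "x \<in> L (b # w) \<longleftrightarrow> x \<in> L w \<and> (b \<longleftrightarrow> x \<in> L (True # w))"
      using children(1)[of w] children(2)[of w] by (cases b) auto
    also have "\<dots> \<longleftrightarrow> w = pre (length w) (c x) \<and> b = c x (length w)"
      using Cons c_def[of x "length w"] k[of x "length w"] by metis
    finally show ?case
      by auto
  qed (simp add: root)
  have inj: "inj c"
  proof (rule injI, rule ccontr)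
    fix x y assume eq: "c x = c y" and "x \<noteq> y"
    then obtain i where i: "x i \<noteq> y i"
      by blast
    obtain n where n: "\<And>w. length w = n \<Longrightarrow> L w \<subseteq> {z. z i = x i} \<or> L w \<inter> {z. z i = x i} = {}"
      using fine[OF clopen_coordinate[of i "x i"]] by auto
    have "x \<in> L (pre n (c x))" "y \<in> L (pre n (c x))"
      by (simp_all add: mem eq)
    then show False
      using n[of "pre n (c x)"] i by auto
  qed
  have cont: "continuous_on UNIV c"
  proof (rule continuous_on_coordinatewise_then_product)
    fix n
    have "open {x. c x n = b}" for b
    proof -
      have "{x. c x n = b} = (\<Union>w\<in>{w. length w = n}. L (b # w))"
        by (auto simp: mem)
      moreover have "open (L w)" for w
        using clopen clopen_def by blast
      ultimately show ?thesis
        by auto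
    qed
    moreover have "(\<lambda>x. c x n) -` B = (\<Union>b\<in>B. {x. c x n = b})" for B
      by auto
    ultimately show "continuous_on UNIV (\<lambda>x. c x n)"
      by (auto simp: continuous_on_open_vimage intro!: open_UN)
  qed
  have img: "range c = {\<sigma>. \<forall>n. L (pre n \<sigma>) \<noteq> {}}"
  proof (intro equalityI subsetI)
    fix \<sigma> assume "\<sigma> \<in> range c"
    then obtain x where "\<sigma> = c x"
      by auto
    then have "x \<in> L (pre n \<sigma>)" for n
      by (simp add: mem)
    then show "\<sigma> \<in> {\<sigma>. \<forall>n. L (pre n \<sigma>) \<noteq> {}}"
      by blast
  next
    fix \<sigma> assume \<sigma>: "\<sigma> \<in> {\<sigma>. \<forall>n. L (pre n \<sigma>) \<noteq> {}}"
    have "L (pre (Suc n) \<sigma>) \<subseteq> L (pre n \<sigma>)" for n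
      using children(1)[of "pre n \<sigma>"] by (cases "\<sigma> n") auto
    then have "decseq (\<lambda>n. L (pre n \<sigma>))"
      by (rule decseq_SucI)
    moreover have "closed (L (pre n \<sigma>))" for n
      using clopen clopen_def by blast
    ultimately have "(\<Inter>n. L (pre n \<sigma>)) \<noteq> {}"
      using closed_decseq_empty[of "\<lambda>n. L (pre n \<sigma>)"] \<sigma> by auto
    then obtain x where x: "\<And>n. x \<in> L (pre n \<sigma>)"
      by blast
    have "\<sigma> i = c x i" for i
      using x[of "Suc i"] by (simp add: mem)
    then have "\<sigma> = c x"
      by blast
    then show "\<sigma> \<in> range c"
      by blast
  qed
  define K where "K = {\<sigma>. \<forall>n. L (pre n \<sigma>) \<noteq> {}}"
  \<comment> \<open>Fineness gives continuity of the inverse: at a suitable depth \<open>n\<close>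
    every node lies inside or outside \<open>cyl m x\<close>. The node of \<open>x\<close> lies
    inside, and the first \<open>n\<close> turns determine it.\<close>
  have "continuous_on K (inv c)"
    unfolding continuous_on_topological
  proof (intro ballI allI impI)
    fix \<sigma> B assume "\<sigma> \<in> K" and B: "open B" "inv c \<sigma> \<in> B"
    then have "\<sigma> \<in> range c"
      unfolding K_def img by simp
    then obtain x where "\<sigma> = c x"
      by blast
    then have x: "\<sigma> = c x" "x \<in> B"
      using B inj by simp_all
    then obtain m where m: "cyl m x \<subseteq> B"
      using open_contains_cyl B by blast
    obtain n where n: "\<And>w. length w = n \<Longrightarrow> L w \<subseteq> cyl m x \<or> L w \<inter> cyl m x = {}"
      using fine[OF clopen_cyl, of m x] by blast
    have "inv c \<tau> \<in> B" if "\<tau> \<in> K" "\<tau> \<in> cyl n \<sigma>" for \<tau>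
    proof -
      have "\<tau> \<in> range c"
        using that(1) unfolding K_def img .
      then obtain z where z: "\<tau> = c z"
        by blast
      then have "pre n (c z) = pre n (c x)"
        using that(2) x by (simp add: cyl_def)
      then have "z \<in> L (pre n (c x))" "x \<in> L (pre n (c x))"
        by (simp_all add: mem)
      then have "z \<in> B"
        using n[of "pre n (c x)"] m by fastforce
      then show ?thesis
        using inj z by simp
    qed
    moreover have "open (cyl n \<sigma>)"
      using clopen_cyl clopen_def by blast
    ultimately show "\<exists>A. open A \<and> \<sigma> \<in> A \<and> (\<forall>\<tau>\<in>K. \<tau> \<in> A \<longrightarrow> inv c \<tau> \<in> B)"
      using in_cyl_self by blast
  qed
  then have "homeomorphism UNIV K c (inv c)"
    using cont inj img by (auto simp: homeomorphism_def K_def[symmetric] f_inv_into_f)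
  then show ?thesis
    using mem unfolding K_def by blast
qed

text \<open>Alternate refinement gives two trees with \<open>P\<close>-related nodes.
  \<open>P_empty\<close> makes the same branches survive in both, so that points can be matched
  along branches; \<open>P_Un\<close> carries \<open>P\<close> from nodes to all clopen
  sets.\<close>

lemma clopen_back_and_forth:
  fixes P :: "cantor set \<Rightarrow> cantor set \<Rightarrow> bool"
  assumes P_clopen: "\<And>A B. P A B \<Longrightarrow> clopen A \<and> clopen B"
    and P_UNIV: "P UNIV UNIV"
    and P_empty: "\<And>A B. P A B \<Longrightarrow> A = {} \<longleftrightarrow> B = {}"
    and P_Un: "\<And>A B A' B'. P A B \<Longrightarrow> P A' B' \<Longrightarrow> A \<inter> A' = {} \<Longrightarrow> B \<inter> B' = {} \<Longrightarrow> P (A \<union> A') (B \<union> B')"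
    and P_forth: "\<And>A B U. P A B \<Longrightarrow> clopen U \<Longrightarrow> U \<subseteq> A \<Longrightarrow> \<exists>W\<subseteq>B. P U W \<and> P (A - U) (B - W)"
    and P_back: "\<And>A B W. P A B \<Longrightarrow> clopen W \<Longrightarrow> W \<subseteq> B \<Longrightarrow> \<exists>U\<subseteq>A. P U W \<and> P (A - U) (B - W)"
  shows "\<exists>h\<in>Homeo. \<forall>U. clopen U \<longrightarrow> P U (h ` U)"
proof -
  \<comment> \<open>Level \<open>2n\<close> of the tree splits every pair \<open>(L w, R w)\<close> along \<open>e n\<close> on the left, level \<open>2n + 1\<close> on the right.\<close>
  define e where "e = from_nat_into (Collect clopen)"
  have e_clopen: "clopen (e n)" for n
    using from_nat_into[of "Collect clopen" n] clopen_UNIV unfolding e_def by blast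
  have e_surj: "\<exists>n. e n = U" if "clopen U" for U
    using from_nat_into_surj[OF countable_clopen, of U] that by (simp add: e_def)
  have "\<forall>A B U. \<exists>W. P A B \<longrightarrow> clopen U \<longrightarrow> W \<subseteq> B \<and> P (A \<inter> U) W \<and> P (A - U) (B - W)"
  proof (intro allI)
    fix A B U
    have "\<exists>W\<subseteq>B. P (A \<inter> U) W \<and> P (A - A \<inter> U) (B - W)" if "P A B" "clopen U"
      using that P_clopen by (intro P_forth) auto
    then show "\<exists>W. P A B \<longrightarrow> clopen U \<longrightarrow> W \<subseteq> B \<and> P (A \<inter> U) W \<and> P (A - U) (B - W)"
      by (metis Diff_Int2 Int_absorb Diff_Int Diff_cancel Un_empty_left)
  qed
  then obtain f where f: "\<And>A B U. P A B \<Longrightarrow> clopen U \<Longrightarrow>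
      f A B U \<subseteq> B \<and> P (A \<inter> U) (f A B U) \<and> P (A - U) (B - f A B U)"
    by metis
  have "\<forall>A B W. \<exists>U. P A B \<longrightarrow> clopen W \<longrightarrow> U \<subseteq> A \<and> P U (B \<inter> W) \<and> P (A - U) (B - W)"
  proof (intro allI)
    fix A B W
    have "\<exists>U\<subseteq>A. P U (B \<inter> W) \<and> P (A - U) (B - B \<inter> W)" if "P A B" "clopen W"
      using that P_clopen by (intro P_back) auto
    then show "\<exists>U. P A B \<longrightarrow> clopen W \<longrightarrow> U \<subseteq> A \<and> P U (B \<inter> W) \<and> P (A - U) (B - W)"
      by (metis Diff_Int2 Int_absorb Diff_Int Diff_cancel Un_empty_left)
  qed
  then obtain b where b: "\<And>A B W. P A B \<Longrightarrow> clopen W \<Longrightarrow>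
      b A B W \<subseteq> A \<and> P (b A B W) (B \<inter> W) \<and> P (A - b A B W) (B - W)"
    by metis
  define split :: "nat \<Rightarrow> cantor set \<times> cantor set \<Rightarrow> cantor set \<times> cantor set" where
    "split n = (\<lambda>(A, B). if even n then (A \<inter> e (n div 2), f A B (e (n div 2)))
                         else (b A B (e (n div 2)), B \<inter> e (n div 2)))" for n
  \<comment> \<open>Both trees come from one recursion. The newest turn is the head of the word, as
    in \<open>pre\<close>, so the tail is the parent and its length is the depth at which it is
    split; the \<open>False\<close> child receives what the split leaves over.\<close>
  define T where "T = rec_list (UNIV, UNIV) (\<lambda>i w r.
      if i then split (length w) r
      else (fst r - fst (split (length w) r), snd r - snd (split (length w) r)))"
  define L where "L w = fst (T w)" for w
  define R where "R w = snd (T w)" for w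
  define S where "S w = split (length w) (L w, R w)" for w
  have split: "fst (split n (A, B)) \<subseteq> A \<and> snd (split n (A, B)) \<subseteq> B \<and>
      P (fst (split n (A, B))) (snd (split n (A, B))) \<and>
      P (A - fst (split n (A, B))) (B - snd (split n (A, B)))" if "P A B" for n A B
  proof -
    have "A - A \<inter> e (n div 2) = A - e (n div 2)" "B - B \<inter> e (n div 2) = B - e (n div 2)"
      by auto
    then show ?thesis
      using f[OF that e_clopen, of "n div 2"] b[OF that e_clopen, of "n div 2"]
      by (auto simp: split_def)
  qed
  have LR_simps: "L [] = UNIV" "R [] = UNIV"
    "L (True # w) = fst (S w)" "R (True # w) = snd (S w)"
    "L (False # w) = L w - fst (S w)" "R (False # w) = R w - snd (S w)" for w
    by (simp_all add: L_def R_def S_def T_def)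
  have PLR: "P (L w) (R w)" for w
  proof (induction w)
    case (Cons i w)
    then show ?case
      using split[OF Cons, of "length w"] by (cases i) (simp_all add: LR_simps S_def)
  qed (simp add: LR_simps P_UNIV)
  have sub: "fst (S w) \<subseteq> L w" "snd (S w) \<subseteq> R w" for w
    using split[OF PLR[of w], of "length w"] by (auto simp: S_def)
  have L_fine: "\<exists>n. \<forall>w. length w = n \<longrightarrow> L w \<subseteq> U \<or> L w \<inter> U = {}" if "clopen U" for U
  proof -
    obtain n where n: "e n = U"
      using e_surj \<open>clopen U\<close> by blast
    \<comment> \<open>Splitting at depth \<open>2 * n\<close> takes effect in the children, one
      level further down; on the right the cut along \<open>e n\<close> happens at depth
      \<open>2 * n + 1\<close>, hence one more \<open>Suc\<close> there.\<close>
    have "L w \<subseteq> U \<or> L w \<inter> U = {}" if len: "length w = Suc (2 * n)" for w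
    proof -
      obtain i v where "w = i # v" "length v = 2 * n"
        using len by (cases w) auto
      then show ?thesis
        by (cases i) (auto simp: LR_simps S_def split_def n)
    qed
    then show ?thesis
      by blast
  qed
  have R_fine: "\<exists>n. \<forall>w. length w = n \<longrightarrow> R w \<subseteq> U \<or> R w \<inter> U = {}" if "clopen U" for U
  proof -
    obtain n where n: "e n = U"
      using e_surj \<open>clopen U\<close> by blast
    have "R w \<subseteq> U \<or> R w \<inter> U = {}" if len: "length w = Suc (Suc (2 * n))" for w
    proof -
      obtain i v where "w = i # v" "length v = Suc (2 * n)"
        using len by (cases w) auto
      then show ?thesis
        by (cases i) (auto simp: LR_simps S_def split_def n)
    qed
    then show ?thesis
      by blast
  qed
  define K where "K = {\<sigma>. \<forall>n. L (pre n \<sigma>) \<noteq> {}}"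
  \<comment> \<open>Related nodes are empty together, so both trees have the same space of surviving
    branches; it is the common image of the two codings.\<close>
  have K': "K = {\<sigma>. \<forall>n. R (pre n \<sigma>) \<noteq> {}}"
    using P_empty[OF PLR] by (simp add: K_def)
  have "\<exists>c c'. homeomorphism UNIV K c c' \<and> (\<forall>x w. x \<in> L w \<longleftrightarrow> w = pre (length w) (c x))"
    unfolding K_def
  proof (rule clopen_tree_coding)
    show "L (True # w) \<union> L (False # w) = L w" "L (True # w) \<inter> L (False # w) = {}" for w
      using sub[of w] by (auto simp: LR_simps)
  qed (use PLR P_clopen L_fine in \<open>auto simp: LR_simps\<close>)
  then obtain c c' where c: "homeomorphism UNIV K c c'" and cL: "\<And>x w. x \<in> L w \<longleftrightarrow> w = pre (length w) (c x)"
    by blast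
  have "\<exists>d d'. homeomorphism UNIV K d d' \<and> (\<forall>x w. x \<in> R w \<longleftrightarrow> w = pre (length w) (d x))"
    unfolding K'
  proof (rule clopen_tree_coding)
    show "R (True # w) \<union> R (False # w) = R w" "R (True # w) \<inter> R (False # w) = {}" for w
      using sub[of w] by (auto simp: LR_simps)
  qed (use PLR P_clopen R_fine in \<open>auto simp: LR_simps\<close>)
  then obtain d d' where d: "homeomorphism UNIV K d d'" and dR: "\<And>x w. x \<in> R w \<longleftrightarrow> w = pre (length w) (d x)"
    by blast
  \<comment> \<open>Read off the branch of a point in the left tree and return to the point with
    this branch in the right tree.\<close>
  define h where "h = d' \<circ> c"
  have hom: "homeomorphism UNIV UNIV h (c' \<circ> d)"
    unfolding h_def using c d homeomorphism_compose homeomorphism_symD by blast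
  have "d (h x) = c x" for x
    using c d by (auto simp: h_def homeomorphism_def)
  then have hLR: "L w = h -` R w" for w
    by (auto simp: cL dR)
  have "surj h"
    using hom by (simp add: homeomorphism_def)
  then have hL: "h ` L w = R w" for w
    unfolding hLR by (rule surj_image_vimage_eq)
  have P_Union: "P (\<Union>(L ` F)) (\<Union>(R ` F))" if "finite F" "F \<subseteq> {w. length w = n}" for F n
    using that
  proof (induction F)
    \<comment> \<open>\<open>P {} {}\<close> comes from cutting the empty set off
      \<open>UNIV\<close>: \<open>P_empty\<close> forces its partner to be empty.\<close>
    case empty
    then show ?case
      using P_forth[OF P_UNIV clopen_empty] P_empty by fastforce
  next
    case (insert w F)
    have "L w \<inter> \<Union>(L ` F) = {}" "R w \<inter> \<Union>(R ` F) = {}"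
      using insert by (fastforce simp: cL dR)+
    then show ?case
      using P_Un[OF PLR] insert by simp
  qed
  have "P U (h ` U)" if U: "clopen U" for U
  proof -
    obtain n where n: "\<And>w. length w = n \<Longrightarrow> L w \<subseteq> U \<or> L w \<inter> U = {}"
      using L_fine[OF U] by blast
    define F where "F = {w. length w = n \<and> L w \<subseteq> U}"
    have "finite F"
      using finite_lists_length_eq[of "UNIV :: bool set" n] by (auto simp: F_def intro: finite_subset[rotated])
    moreover have U_eq: "U = \<Union>(L ` F)"
    proof -
      have "x \<in> \<Union>(L ` F)" if "x \<in> U" for x
      proof -
        have "x \<in> L (pre n (c x))"
          by (simp add: cL)
        then show ?thesis
          using n[of "pre n (c x)"] that by (force simp: F_def)
      qed
      then show ?thesis
        by (auto simp: F_def)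
    qed
    moreover have "h ` U = \<Union>(R ` F)"
      by (subst U_eq) (simp only: image_UN hL)
    moreover have "F \<subseteq> {w. length w = n}"
      by (auto simp: F_def)
    ultimately show ?thesis
      using P_Union[of F n] by metis
  qed
  then show ?thesis
    using hom by (auto simp: Homeo_def)
qed

section \<open>Measures and their clopen values\<close>

lemma ProbD:
  assumes "M \<in> Prob"
  shows "prob_space M" "sets M = sets borel" "space M = UNIV"
  using assms sets_eq_imp_space_eq[of M borel] by (auto simp: Prob_def)

lemma clopen_sets:
  assumes "M \<in> Prob" "clopen U"
  shows "U \<in> sets M"
  using assms ProbD(2) by (simp add: clopen_def)

lemma measure_UNIV_Prob [simp]: "M \<in> Prob \<Longrightarrow> measure M UNIV = 1"
  using prob_space.prob_space ProbD by metis

lemma measure_clopen_Un: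
  assumes "M \<in> Prob" "clopen A" "clopen B" "A \<inter> B = {}"
  shows "measure M (A \<union> B) = measure M A + measure M B"
proof -
  interpret prob_space M
    using assms ProbD by blast
  show ?thesis
    using assms clopen_sets finite_measure_Union by simp
qed

lemma measure_clopen_Diff:
  assumes "M \<in> Prob" "clopen A" "clopen B" "B \<subseteq> A"
  shows "measure M (A - B) = measure M A - measure M B"
proof -
  have "A - B \<union> B = A"
    using assms by blast
  then show ?thesis
    using measure_clopen_Un[of M "A - B" B] assms by force
qed

lemma measure_clopen_mono:
  assumes "M \<in> Prob" "clopen A" "B \<subseteq> A"
  shows "measure M B \<le> measure M A"
proof -
  interpret prob_space M
    using assms ProbD by blast
  show ?thesis
    using assms clopen_sets finite_measure_mono by simp
qed

lemma measure_eq_sum_cyls: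
  assumes "M \<in> Prob" "\<forall>x. cyl n x \<subseteq> U \<or> cyl n x \<inter> U = {}"
  shows "measure M U = (\<Sum>C\<in>cyl n ` U. measure M C)"
proof -
  interpret prob_space M
    using assms ProbD by blast
  have "finite (cyl n ` U)"
    by (rule finite_subset[OF _ finite_cyls[of n]]) blast
  moreover have "disjoint_family_on (\<lambda>C. C) (cyl n ` U)"
    unfolding disjoint_family_on_def using disjoint_cyls by blast
  ultimately have "measure M (\<Union>C\<in>cyl n ` U. C) = (\<Sum>C\<in>cyl n ` U. measure M C)"
    using clopen_sets[OF assms(1)] by (intro finite_measure_finite_Union) auto
  then show ?thesis
    using eq_Union_cyls[OF assms(2)] by simp
qed

text \<open>Every nonempty open set contains a cylinder. Fullness thereby becomes a countable family
  of conditions.\<close>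

lemma full_iff:
  assumes "M \<in> Prob"
  shows "full M \<longleftrightarrow> (\<forall>U. clopen U \<and> U \<noteq> {} \<longrightarrow> measure M U > 0)"
proof
  assume R: "\<forall>U. clopen U \<and> U \<noteq> {} \<longrightarrow> measure M U > 0"
  interpret prob_space M
    using assms ProbD by blast
  show "full M"
    unfolding full_def
  proof (intro allI impI)
    fix U :: "cantor set" assume U: "open U \<and> U \<noteq> {}"
    then obtain x n where "cyl n x \<subseteq> U"
      using open_contains_cyl by blast
    then have "measure M (cyl n x) \<le> measure M U"
      using U ProbD(2)[OF assms] by (intro finite_measure_mono) auto
    moreover have "measure M (cyl n x) > 0"
      using R in_cyl_self[of x n] by (metis clopen_cyl empty_iff)
    ultimately show "0 < measure M U"
      by linarith
  qed
qed (auto simp: full_def clopen_def)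

text \<open>As there are only countably many clopen sets, each open set is a countable union of
  them.\<close>

lemma borel_eq_sigma_clopen: "sets (borel :: cantor measure) = sigma_sets UNIV (Collect clopen)"
proof
  have "U \<in> sigma_sets UNIV (Collect clopen)" if "open U" for U
  proof -
    have "U = \<Union>{A. clopen A \<and> A \<subseteq> U}"
    proof (intro equalityI subsetI)
      fix x assume "x \<in> U"
      then obtain n where "cyl n x \<subseteq> U"
        using open_contains_cyl \<open>open U\<close> by blast
      then show "x \<in> \<Union>{A. clopen A \<and> A \<subseteq> U}"
        using clopen_cyl in_cyl_self by blast
    qed auto
    moreover have "countable {A. clopen A \<and> A \<subseteq> U}"
      by (rule countable_subset[OF _ countable_clopen]) auto
    ultimately show ?thesis
      by (metis (no_types, lifting) mem_Collect_eq sigma_sets.Basic sigma_sets_UNION)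
  qed
  then have "Collect open \<subseteq> sigma_sets UNIV (Collect clopen)"
    by auto
  from sigma_sets_mono[OF this]
  show "sets (borel :: cantor measure) \<subseteq> sigma_sets UNIV (Collect clopen)"
    by (simp add: borel_def)
  have "Collect clopen \<subseteq> sets (borel :: cantor measure)"
    by (auto simp: clopen_def)
  then show "sigma_sets UNIV (Collect clopen) \<subseteq> sets (borel :: cantor measure)"
    using sets.sigma_sets_subset[of "Collect clopen" borel] by simp
qed

text \<open>The clopen sets form a generating pi-system.\<close>

lemma Prob_eqI:
  assumes M: "M \<in> Prob" and N: "N \<in> Prob" and eq: "\<And>U. clopen U \<Longrightarrow> measure M U = measure N U"
  shows "M = N"
proof (rule measure_eqI_generator_eq[where E="Collect clopen" and \<Omega>=UNIV and A="\<lambda>_. UNIV"])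
  interpret M: prob_space M
    using M ProbD by blast
  interpret N: prob_space N
    using N ProbD by blast
  show "Int_stable (Collect clopen)"
    by (auto simp: Int_stable_def)
  show "emeasure M X = emeasure N X" if "X \<in> Collect clopen" for X
    using eq that by (simp add: M.emeasure_eq_measure N.emeasure_eq_measure)
  show "emeasure M UNIV \<noteq> \<infinity>" for i :: nat
    by simp
qed (use ProbD[OF M] ProbD[OF N] borel_eq_sigma_clopen in auto)

text \<open>Countable additivity is automatic: by compactness a decreasing sequence of clopen sets
  with empty intersection is eventually empty, so Caratheodory's theorem applies. Hence limits of
  clopen values are again values of a measure, which gives completeness of the strong
  topology.\<close>

lemma clopen_measure_extension:
  fixes \<phi> :: "cantor set \<Rightarrow> real"
  assumes nonneg: "\<And>U. clopen U \<Longrightarrow> 0 \<le> \<phi> U"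
    and add: "\<And>A B. clopen A \<Longrightarrow> clopen B \<Longrightarrow> A \<inter> B = {} \<Longrightarrow> \<phi> (A \<union> B) = \<phi> A + \<phi> B"
    and total: "\<phi> UNIV = 1"
  shows "\<exists>M\<in>Prob. \<forall>U. clopen U \<longrightarrow> measure M U = \<phi> U"
proof -
  interpret ring_of_sets UNIV "Collect clopen"
    by (auto simp: ring_of_sets_iff)
  have empty: "\<phi> {} = 0"
    using add[of "{}" "{}"] by simp
  have "\<exists>\<mu>. (\<forall>U\<in>Collect clopen. \<mu> U = ennreal (\<phi> U)) \<and>
          measure_space UNIV (sigma_sets UNIV (Collect clopen)) \<mu>"
  proof (rule caratheodory_empty_continuous)
    show "positive (Collect clopen) (\<lambda>U. ennreal (\<phi> U))"
      by (simp add: positive_def empty)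
    show "additive (Collect clopen) (\<lambda>U. ennreal (\<phi> U))"
      by (auto simp: additive_def add nonneg)
    fix A :: "nat \<Rightarrow> cantor set"
    assume A: "range A \<subseteq> Collect clopen" "decseq A" "(\<Inter>i. A i) = {}"
    then have "closed (A i)" for i
      by (auto simp: clopen_def image_subset_iff)
    then obtain i where "A i = {}"
      using closed_decseq_empty[of A] A by auto
    then have "A j = {}" if "j \<ge> i" for j
      using A(2) that by (auto simp: decseq_def)
    then have "\<forall>\<^sub>F j in sequentially. ennreal (\<phi> (A j)) = 0"
      unfolding eventually_sequentially by (metis empty ennreal_0)
    then show "(\<lambda>i. ennreal (\<phi> (A i))) \<longlonglongrightarrow> 0"
      by (rule tendsto_eventually)
  qed simp
  then obtain \<mu> where \<mu>: "\<And>U. clopen U \<Longrightarrow> \<mu> U = ennreal (\<phi> U)"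
    "measure_space UNIV (sigma_sets UNIV (Collect clopen)) \<mu>"
    by auto
  define M where "M = measure_of UNIV (Collect clopen) \<mu>"
  have sets: "sets M = sets borel"
    by (simp add: M_def borel_eq_sigma_clopen)
  have em: "emeasure M X = \<mu> X" if "X \<in> sets M" for X
    using \<mu>(2) that by (intro emeasure_measure_of[OF M_def])
      (auto simp: measure_space_def sets borel_eq_sigma_clopen)
  have eq: "emeasure M U = ennreal (\<phi> U)" if "clopen U" for U
    using em[of U] \<mu>(1) that sets by (auto simp: clopen_def)
  have "prob_space M"
    using eq[OF clopen_UNIV] total sets_eq_imp_space_eq[OF sets] by (intro prob_spaceI) simp
  moreover have "measure M U = \<phi> U" if "clopen U" for U
    using eq[OF that] nonneg[OF that] by (simp add: measure_def)
  ultimately show ?thesis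
    using sets by (auto simp: Prob_def)
qed

section \<open>Pushforwards under homeomorphisms\<close>

lemma distr_Homeo:
  assumes "h \<in> Homeo" "M \<in> Prob"
  shows "distr M borel h \<in> Prob" "\<And>U. clopen U \<Longrightarrow> measure (distr M borel h) U = measure M (h -` U)"
proof -
  have "continuous_on UNIV h"
    using assms by (auto simp: Homeo_def homeomorphism_def)
  then have h: "h \<in> measurable M borel"
    using borel_measurable_continuous_onI measurable_cong_sets[OF ProbD(2)[OF assms(2)]] by blast
  then show "distr M borel h \<in> Prob"
    using ProbD[OF assms(2)] by (simp add: Prob_def prob_space.prob_space_distr)
  show "measure (distr M borel h) U = measure M (h -` U)" if "clopen U" for U
    using that ProbD[OF assms(2)] h by (subst measure_distr) (auto simp: clopen_def)
qed

lemma clopen_vimage_Homeo: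
  assumes "h \<in> Homeo" "clopen U"
  shows "clopen (h -` U)"
  using assms by (auto simp: Homeo_def homeomorphism_def clopen_def open_vimage closed_vimage)

lemma inv_Homeo:
  assumes "h \<in> Homeo"
  shows "\<exists>g\<in>Homeo. (\<forall>x. g (h x) = x) \<and> (\<forall>x. h (g x) = x)"
proof -
  obtain g where "homeomorphism UNIV UNIV h g"
    using assms by (auto simp: Homeo_def)
  then have "g \<in> Homeo" "\<forall>x. g (h x) = x" "\<forall>x. h (g x) = x"
    using homeomorphism_symD by (auto simp: Homeo_def homeomorphism_def)
  then show ?thesis
    by blast
qed

section \<open>Integrals of continuous functions\<close>

lemma integrable_continuous_Prob:
  fixes f :: "cantor \<Rightarrow> real"
  assumes "M \<in> Prob" "continuous_on UNIV f"
  shows "integrable M f"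
proof -
  interpret prob_space M
    using assms ProbD by blast
  have "bounded (range f)"
    using assms(2) compact_cantor by (simp add: compact_continuous_image compact_imp_bounded)
  then obtain B where "\<And>x. norm (f x) \<le> B"
    by (auto simp: bounded_iff)
  moreover have "f \<in> borel_measurable M"
    using borel_measurable_continuous_onI[OF assms(2)] measurable_cong_sets[OF ProbD(2)[OF assms(1)]] by blast
  ultimately show ?thesis
    by (intro integrable_const_bound[of _ B]) auto
qed

text \<open>Replace \<open>f\<close> by the step function with value \<open>r C\<close> on
  \<open>C\<close>; the integrals differ by at most the uniform distance. The sum sees only the
  measures of cylinders of level \<open>n\<close>, so measures agreeing there have integrals within
  \<open>2 * \<epsilon>\<close>.\<close>

lemma integral_approx_cyls:
  fixes f :: "cantor \<Rightarrow> real"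
  assumes M: "M \<in> Prob" and f: "continuous_on UNIV f"
    and rep: "\<And>x. \<bar>f x - r (cyl n x)\<bar> \<le> \<epsilon>"
  shows "\<bar>(\<integral>x. f x \<partial>M) - (\<Sum>C\<in>range (cyl n). r C * measure M C)\<bar> \<le> \<epsilon>"
proof -
  interpret prob_space M
    using M ProbD by blast
  define g where "g x = (\<Sum>C\<in>range (cyl n). r C * indicator C x)" for x
  have C: "C \<in> sets M" if "C \<in> range (cyl n)" for C
    using that clopen_sets[OF M] by auto
  have ind: "integrable M (\<lambda>x. r C * indicator C x)" if "C \<in> range (cyl n)" for C
    using C[OF that] by (intro integrable_mult_right) (simp add: emeasure_eq_measure)
  then have g: "integrable M g"
    unfolding g_def by (rule Bochner_Integration.integrable_sum)
  have "(\<integral>x. g x \<partial>M) = (\<Sum>C\<in>range (cyl n). \<integral>x. r C * indicator C x \<partial>M)"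
    unfolding g_def using ind by (rule Bochner_Integration.integral_sum)
  also have "\<dots> = (\<Sum>C\<in>range (cyl n). r C * measure M C)"
    using ProbD(3)[OF M] by (intro sum.cong) auto
  finally have int_g: "(\<integral>x. g x \<partial>M) = (\<Sum>C\<in>range (cyl n). r C * measure M C)" .
  have gx: "g x = r (cyl n x)" for x
  proof -
    have "g x = (\<Sum>C\<in>range (cyl n). if C = cyl n x then r C else 0)"
      unfolding g_def
    proof (rule sum.cong)
      fix C assume "C \<in> range (cyl n)"
      then show "r C * indicator C x = (if C = cyl n x then r C else 0)"
        using cyl_eq[of x n] by (auto simp: indicator_def)
    qed simp
    then show ?thesis
      by (simp add: finite_cyls)
  qed
  have "\<bar>(\<integral>x. f x \<partial>M) - (\<integral>x. g x \<partial>M)\<bar> = \<bar>\<integral>x. f x - g x \<partial>M\<bar>"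
    using g integrable_continuous_Prob[OF M f] by simp
  also have "\<dots> \<le> (\<integral>x. \<bar>f x - g x\<bar> \<partial>M)"
    by (rule integral_abs_bound)
  also have "\<dots> \<le> (\<integral>x. \<epsilon> \<partial>M)"
    using rep by (intro integral_mono integrable_abs Bochner_Integration.integrable_diff g
        integrable_continuous_Prob[OF M f]) (auto simp: gx)
  also have "\<dots> = \<epsilon>"
    by (simp add: prob_space)
  finally show ?thesis
    by (simp add: int_g)
qed

section \<open>Good measures and their conjugacy classes\<close>

lemma goodD:
  assumes "good M"
  shows "M \<in> Prob" "full M"
    "\<And>U W. clopen U \<Longrightarrow> clopen W \<Longrightarrow> measure M U < measure M W \<Longrightarrow>
      \<exists>W'. clopen W' \<and> W' \<subseteq> W \<and> measure M W' = measure M U"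
  using assms by (auto simp: good_def)

lemma full_null_clopen:
  assumes "M \<in> Prob" "full M" "clopen U"
  shows "measure M U = 0 \<longleftrightarrow> U = {}"
  using assms full_iff by force

text \<open>The value of \<open>U\<close> is also a value of \<open>N\<close>, and goodness of
  \<open>N\<close> finds it inside \<open>B\<close>; the remainders then agree by subtraction.
  Exchanging the two measures gives the step back.\<close>

lemma good_split_forth:
  assumes M: "good M" and N: "good N" and sub: "clopen_values M \<subseteq> clopen_values N"
    and A: "clopen A" and B: "clopen B" and eq: "measure M A = measure N B"
    and U: "clopen U" "U \<subseteq> A"
  shows "\<exists>W\<subseteq>B. clopen W \<and> measure M U = measure N W \<and> measure M (A - U) = measure N (B - W)"
proof -
  have "\<exists>W\<subseteq>B. clopen W \<and> measure M U = measure N W"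
  proof (cases "measure M U < measure M A")
    case True
    obtain U' where "clopen U'" "measure M U = measure N U'"
      using sub U(1) by (force simp: clopen_values_def)
    then show ?thesis
      using goodD(3)[OF N, of U' B] True eq B by metis
  next
    \<comment> \<open>Goodness requires strict inequality. In the remaining case \<open>U\<close>
      has the full measure of \<open>A\<close>, and \<open>B\<close> itself is taken.\<close>
    case False
    then have "measure M U = measure N B"
      using measure_clopen_mono[OF goodD(1)[OF M] A U(2)] eq by linarith
    then show ?thesis
      using B by blast
  qed
  then obtain W where "W \<subseteq> B" "clopen W" "measure M U = measure N W"
    by blast
  moreover from this have "measure M (A - U) = measure N (B - W)"
    using measure_clopen_Diff[OF goodD(1)[OF M] A U] measure_clopen_Diff[OF goodD(1)[OF N] B, of W] eq
    by simp
  ultimately show ?thesis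
    by blast
qed

text \<open>Back and forth with equality of measure as the relation. Fullness makes the null clopen
  sets exactly the empty ones, which is the emptiness condition; the resulting map preserves all
  clopen values, and these determine the measure.\<close>

lemma good_conjugate:
  assumes M: "good M" and N: "good N" and eq: "clopen_values M = clopen_values N"
  shows "N \<in> conjugacy_class M"
proof -
  note MP = goodD(1)[OF M] and NP = goodD(1)[OF N]
  have "\<exists>h\<in>Homeo. \<forall>U. clopen U \<longrightarrow> clopen U \<and> clopen (h ` U) \<and> measure M U = measure N (h ` U)"
  proof (rule clopen_back_and_forth[where P="\<lambda>A B. clopen A \<and> clopen B \<and> measure M A = measure N B"])
    fix A B assume AB: "clopen A \<and> clopen B \<and> measure M A = measure N B"
    then show "A = {} \<longleftrightarrow> B = {}"
      using full_null_clopen goodD M N by metis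
    show "\<exists>W\<subseteq>B. (clopen U \<and> clopen W \<and> measure M U = measure N W) \<and>
        (clopen (A - U) \<and> clopen (B - W) \<and> measure M (A - U) = measure N (B - W))"
      if "clopen U" "U \<subseteq> A" for U
      using good_split_forth[OF M N _ _ _ _ that, of B] AB eq that by blast
    show "\<exists>U\<subseteq>A. (clopen U \<and> clopen W \<and> measure M U = measure N W) \<and>
        (clopen (A - U) \<and> clopen (B - W) \<and> measure M (A - U) = measure N (B - W))"
      if "clopen W" "W \<subseteq> B" for W
      using good_split_forth[OF N M _ _ _ _ that, of A] AB eq that by (metis clopen_Diff order_refl)
  qed (auto simp: MP NP measure_clopen_Un)
  then obtain h where h: "h \<in> Homeo" "\<And>U. clopen U \<Longrightarrow> measure M U = measure N (h ` U)"
    by blast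
  have "N = distr M borel h"
  proof (rule Prob_eqI[OF NP distr_Homeo(1)[OF h(1) MP]])
    fix U assume U: "clopen U"
    have "surj h"
      using h(1) by (auto simp: Homeo_def homeomorphism_def)
    then show "measure N U = measure (distr M borel h) U"
      using h(2)[OF clopen_vimage_Homeo[OF h(1) U]] distr_Homeo(2)[OF h(1) MP U]
      by (simp add: surj_image_vimage_eq)
  qed
  then show ?thesis
    using h(1) by (auto simp: conjugacy_class_def)
qed

lemma Full_distr_Homeo:
  assumes "M \<in> Full V" "h \<in> Homeo"
  shows "distr M borel h \<in> Full V"
proof -
  have M: "M \<in> Prob" "full M" "clopen_values M \<subseteq> V"
    using assms by (auto simp: Full_def)
  have "surj h"
    using assms(2) by (auto simp: Homeo_def homeomorphism_def)
  then have "full (distr M borel h)"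
    using M distr_Homeo[OF assms(2) M(1)] clopen_vimage_Homeo[OF assms(2)]
    by (auto simp: full_iff surj_vimage_empty)
  moreover have "clopen_values (distr M borel h) \<subseteq> V"
    using M(3) distr_Homeo(2)[OF assms(2) M(1)] clopen_vimage_Homeo[OF assms(2)]
    by (fastforce simp: clopen_values_def)
  ultimately show ?thesis
    using distr_Homeo(1)[OF assms(2) M(1)] by (simp add: Full_def)
qed

lemma distr_distr_Homeo:
  assumes "g \<in> Homeo" "h \<in> Homeo" "M \<in> Prob"
  shows "distr (distr M borel h) borel g = distr M borel (g \<circ> h)" "g \<circ> h \<in> Homeo"
proof -
  show gh: "g \<circ> h \<in> Homeo"
    using assms(1,2) homeomorphism_compose by (fastforce simp: Homeo_def)
  show "distr (distr M borel h) borel g = distr M borel (g \<circ> h)"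
    using assms gh by (intro Prob_eqI) (auto simp: distr_Homeo clopen_vimage_Homeo vimage_comp)
qed

lemma conjugacy_class_eq:
  assumes M: "M \<in> Prob" and N: "N \<in> conjugacy_class M"
  shows "conjugacy_class N = conjugacy_class M"
proof -
  obtain h where h: "h \<in> Homeo" "N = distr M borel h"
    using N by (auto simp: conjugacy_class_def)
  obtain g where g: "g \<in> Homeo" "\<And>x. g (h x) = x"
    using inv_Homeo[OF h(1)] by blast
  have NP: "N \<in> Prob"
    using h distr_Homeo M by simp
  have "M = distr N borel g"
  proof (rule Prob_eqI[OF M distr_Homeo(1)[OF g(1) NP]])
    fix U assume U: "clopen U"
    have "h -` (g -` U) = U"
      using g(2) by auto
    then show "measure M U = measure (distr N borel g) U"
      using distr_Homeo(2)[OF g(1) NP U] distr_Homeo(2)[OF h(1) M clopen_vimage_Homeo[OF g(1) U]] h(2)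
      by simp
  qed
  have "conjugacy_class N \<subseteq> conjugacy_class M"
    using distr_distr_Homeo[OF _ h(1) M] h(2) by (fastforce simp: conjugacy_class_def)
  moreover have "conjugacy_class M \<subseteq> conjugacy_class N"
    using distr_distr_Homeo[OF _ g(1) NP] \<open>M = distr N borel g\<close> by (fastforce simp: conjugacy_class_def)
  ultimately show ?thesis
    by blast
qed

text \<open>The condition follows from goodness of \<open>M\<close> and is transported by
  homeomorphisms. Conversely, taking for \<open>v\<close> a value of \<open>N\<close> gives
  goodness, and \<open>W = UNIV\<close> gives all values in \<open>V\<close>; good measures with
  equal clopen values are conjugate.\<close>

lemma mem_good_conjugacy_class_iff:
  assumes M: "good M" and V: "clopen_values M = V"
  shows "N \<in> conjugacy_class M \<longleftrightarrow> N \<in> Full V \<and>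
    (\<forall>W v. clopen W \<and> v \<in> V \<longrightarrow> measure N W \<le> v \<or> (\<exists>W'\<subseteq>W. clopen W' \<and> measure N W' = v))"
    (is "?L \<longleftrightarrow> N \<in> Full V \<and> ?R")
proof
  note MP = goodD(1)[OF M]
  assume ?L
  then obtain h where h: "h \<in> Homeo" and N: "N = distr M borel h"
    by (auto simp: conjugacy_class_def)
  obtain g where g: "g \<in> Homeo" "\<And>x. g (h x) = x" "\<And>x. h (g x) = x"
    using inv_Homeo[OF h] by blast
  have "measure N W \<le> v \<or> (\<exists>W'\<subseteq>W. clopen W' \<and> measure N W' = v)"
    if W: "clopen W" and v: "v \<in> V" for W v
  proof -
    have "\<exists>W'\<subseteq>W. clopen W' \<and> measure N W' = v" if "\<not> measure N W \<le> v"
    proof -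
      have "v < measure M (h -` W)"
        using that N distr_Homeo(2)[OF h MP W] by simp
      moreover obtain U where "clopen U" "v = measure M U"
        using V v by (auto simp: clopen_values_def)
      ultimately obtain U' where U': "clopen U'" "U' \<subseteq> h -` W" "measure M U' = v"
        using goodD(3)[OF M] clopen_vimage_Homeo[OF h W] by metis
      have "clopen (g -` U')" "g -` U' \<subseteq> W" "h -` (g -` U') = U'"
        using clopen_vimage_Homeo[OF g(1)] U' g by (auto simp: vimage_def)
      then show ?thesis
        using N distr_Homeo(2)[OF h MP] U'(3) by metis
    qed
    then show ?thesis
      by blast
  qed
  moreover have "N \<in> Full V"
    using Full_distr_Homeo[OF _ h, of M V] goodD[OF M] V N by (simp add: Full_def)
  ultimately show "N \<in> Full V \<and> ?R"
    by blast
next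
  assume R: "N \<in> Full V \<and> ?R"
  then have N: "N \<in> Prob" "full N" "clopen_values N \<subseteq> V"
    by (auto simp: Full_def)
  have "good N"
    unfolding good_def
  proof (intro conjI allI impI N)
    fix U W assume UW: "clopen U \<and> clopen W \<and> measure N U < measure N W"
    then have "measure N U \<in> V"
      using N(3) by (auto simp: clopen_values_def)
    then show "\<exists>W'. clopen W' \<and> W' \<subseteq> W \<and> measure N W' = measure N U"
      using R UW by (metis not_less)
  qed
  moreover have "v \<in> clopen_values N" if v: "v \<in> V" for v
  proof -
    have "v \<le> 1"
      using v V measure_clopen_mono[OF goodD(1)[OF M] clopen_UNIV subset_UNIV] goodD(1)[OF M]
      by (auto simp: clopen_values_def)
    have "\<exists>W. clopen W \<and> measure N W = v"
    \<comment> \<open>The condition yields values strictly below that of \<open>W\<close>; the value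
      1 is attained by the whole space.\<close>
    proof (cases "v = 1")
      case True
      then show ?thesis
        using N(1) by (intro exI[of _ UNIV]) simp
    next
      case False
      then have "\<not> measure N UNIV \<le> v"
        using \<open>v \<le> 1\<close> N(1) by simp
      then show ?thesis
        using R v clopen_UNIV by blast
    qed
    then show ?thesis
      by (auto simp: clopen_values_def)
  qed
  ultimately show ?L
    using good_conjugate[OF M] V N(3) by blast
qed

section \<open>Clopen partitions with prescribed measures, and homeomorphisms matching
  partitions\<close>

lemma good_clopen_partition:
  assumes M: "good M" and "finite I" and v: "\<And>i. i \<in> I \<Longrightarrow> v i \<in> clopen_values M"
    and W: "clopen W" "measure M W = (\<Sum>i\<in>I. v i)"
  shows "\<exists>B. (\<forall>i\<in>I. clopen (B i) \<and> measure M (B i) = v i) \<and> disjoint_family_on B I \<and> (\<Union>i\<in>I. B i) = W"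
  using \<open>finite I\<close> v W
proof (induction I arbitrary: W)
  \<comment> \<open>The empty sum is 0, and fullness turns measure 0 into
    \<open>W = {}\<close>.\<close>
  case empty
  then show ?case
    using full_null_clopen goodD[OF M] by (auto simp: disjoint_family_on_def)
next
  case (insert i I)
  have "v j \<ge> 0" if "j \<in> I" for j
    using insert.prems(1)[of j] that by (auto simp: clopen_values_def)
  then have le: "v i \<le> measure M W"
    using insert by (simp add: sum_nonneg)
  obtain U where U: "clopen U" "v i = measure M U"
    using insert.prems(1)[of i] by (auto simp: clopen_values_def)
  \<comment> \<open>Goodness gives a part of measure \<open>v i\<close> if \<open>W\<close> has
    strictly larger measure; in case of equality \<open>W\<close> itself is used.\<close>
  have "\<exists>W'\<subseteq>W. clopen W' \<and> measure M W' = v i"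
    using le goodD(3)[OF M U(1) insert.prems(2)] insert.prems(2) U(2)
    by (cases "v i = measure M W") (auto simp: less_le)
  then obtain W' where W': "W' \<subseteq> W" "clopen W'" "measure M W' = v i"
    by blast
  then have "measure M (W - W') = (\<Sum>j\<in>I. v j)"
    using measure_clopen_Diff[OF goodD(1)[OF M] insert.prems(2) W'(2,1)] insert by simp
  then obtain B where B: "\<forall>j\<in>I. clopen (B j) \<and> measure M (B j) = v j" "disjoint_family_on B I"
    "(\<Union>j\<in>I. B j) = W - W'"
    using insert.IH[of "W - W'"] insert.prems W' by auto
  show ?case
  proof (intro exI conjI)
    show "\<forall>j\<in>insert i I. clopen ((B(i := W')) j) \<and> measure M ((B(i := W')) j) = v j"
      using B W' by simp
    have eq: "(B(i := W')) j = B j" if "j \<in> I" for j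
      using insert.hyps(2) that by auto
    then have "(\<Union>j\<in>I. (B(i := W')) j) = W - W'"
      using B(3) by simp
    then show "(\<Union>j\<in>insert i I. (B(i := W')) j) = W"
      using W'(1) by (simp only: UN_insert fun_upd_same) blast
    have "disjoint_family_on (B(i := W')) I"
      using B(2) eq by (simp add: disjoint_family_on_def)
    moreover have "W' \<inter> (\<Union>j\<in>I. (B(i := W')) j) = {}"
      using \<open>(\<Union>j\<in>I. (B(i := W')) j) = W - W'\<close> by blast
    ultimately show "disjoint_family_on (B(i := W')) (insert i I)"
      using insert.hyps(2) by (simp add: disjoint_family_on_insert)
  qed
qed

text \<open>Inside each \<open>A i\<close> the set \<open>W\<close> must take nothing, everything or
  a proper part of \<open>Y\<close>, according to how \<open>U\<close> divides \<open>X\<close>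
  inside \<open>B i\<close>. The proper parts come from a single clopen \<open>C\<close> that splits
  all nonempty \<open>Y \<inter> A i\<close>.\<close>

lemma clopen_partition_split:
  assumes A: "finite I" "disjoint_family_on A I" "\<And>i. i \<in> I \<Longrightarrow> clopen (A i)"
    and Y: "clopen Y" and XY: "\<And>i. i \<in> I \<Longrightarrow> X \<inter> B i = {} \<longleftrightarrow> Y \<inter> A i = {}" and U: "U \<subseteq> X"
  shows "\<exists>W\<subseteq>Y. clopen W \<and> (\<forall>i\<in>I. (U \<inter> B i = {} \<longleftrightarrow> W \<inter> A i = {}) \<and>
           ((X - U) \<inter> B i = {} \<longleftrightarrow> (Y - W) \<inter> A i = {}))"
proof -
  have "clopen (Y \<inter> A i)" if "i \<in> I" for i
    using A(3)[OF that] Y by auto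
  then obtain C where C: "clopen C" "\<And>i. i \<in> I \<Longrightarrow> Y \<inter> A i \<noteq> {} \<Longrightarrow> Y \<inter> A i \<inter> C \<noteq> {} \<and> Y \<inter> A i - C \<noteq> {}"
    using proper_clopen_split[of I "\<lambda>i. Y \<inter> A i"] A(1) by blast
  define T where "T i = (if U \<inter> B i = {} then {} else if (X - U) \<inter> B i = {} then Y \<inter> A i
                         else Y \<inter> A i \<inter> C)" for i
  define W where "W = (\<Union>i\<in>I. T i)"
  have T_sub: "T i \<subseteq> Y \<inter> A i" for i
    by (auto simp: T_def)
  have WA: "W \<inter> A i = T i" if i: "i \<in> I" for i
  proof -
    have "T j \<inter> A i = {}" if "j \<in> I" "j \<noteq> i" for j
      using T_sub[of j] A(2) i that unfolding disjoint_family_on_def by blast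
    then show ?thesis
      using T_sub[of i] i unfolding W_def by blast
  qed
  have WC: "clopen W"
    unfolding W_def using A C(1) Y by (intro clopen_UN) (simp_all add: T_def clopen_Int)
  have WY: "W \<subseteq> Y"
    using T_sub by (auto simp: W_def)
  have W: "(U \<inter> B i = {} \<longleftrightarrow> W \<inter> A i = {}) \<and> ((X - U) \<inter> B i = {} \<longleftrightarrow> (Y - W) \<inter> A i = {})"
    if i: "i \<in> I" for i
  proof -
    have *: "(Y - W) \<inter> A i = Y \<inter> A i - T i"
      using WA[OF i] by blast
    show ?thesis
    proof (cases "Y \<inter> A i = {}")
      case True
      then have "X \<inter> B i = {}"
        using XY i by blast
      then show ?thesis
        using True T_sub[of i] WA[OF i] U by blast
    next
      case False
      then have "X \<inter> B i \<noteq> {}"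
        using XY i by blast
      then show ?thesis
        using C(2)[OF i False] False U unfolding * WA[OF i] by (simp add: T_def) blast
    qed
  qed
  show ?thesis
    by (rule exI[of _ W], intro conjI WY WC, rule ballI, rule W)
qed

text \<open>Back and forth with a relation that remembers only which pieces are met. Nonempty clopen
  sets can always be split, so no measure has to be matched. As \<open>B j\<close> misses the other
  \<open>B k\<close>, its image misses the other \<open>A k\<close> and lies in
  \<open>A j\<close>.\<close>

lemma homeo_clopen_partitions:
  assumes I: "finite I"
    and A: "disjoint_family_on A I" "\<And>i. i \<in> I \<Longrightarrow> clopen (A i)" "\<And>i. i \<in> I \<Longrightarrow> A i \<noteq> {}" "(\<Union>i\<in>I. A i) = UNIV"
    and B: "disjoint_family_on B I" "\<And>i. i \<in> I \<Longrightarrow> clopen (B i)" "\<And>i. i \<in> I \<Longrightarrow> B i \<noteq> {}" "(\<Union>i\<in>I. B i) = UNIV"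
  shows "\<exists>h\<in>Homeo. \<forall>i\<in>I. h -` A i = B i"
proof -
  define P where "P X Y \<longleftrightarrow> clopen X \<and> clopen Y \<and> (\<forall>i\<in>I. X \<inter> B i = {} \<longleftrightarrow> Y \<inter> A i = {})" for X Y
  have "\<exists>h\<in>Homeo. \<forall>U. clopen U \<longrightarrow> P U (h ` U)"
  proof (rule clopen_back_and_forth)
    fix X Y assume XY: "P X Y"
    have "X = {} \<longleftrightarrow> (\<forall>i\<in>I. X \<inter> B i = {})" "Y = {} \<longleftrightarrow> (\<forall>i\<in>I. Y \<inter> A i = {})"
      using A(4) B(4) by blast+
    then show "X = {} \<longleftrightarrow> Y = {}"
      using XY by (simp add: P_def)
    show "P (X \<union> X') (Y \<union> Y')" if "P X' Y'" for X' Y'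
      using XY that by (auto simp: P_def Int_Un_distrib2)
    show "\<exists>W\<subseteq>Y. P U W \<and> P (X - U) (Y - W)" if "clopen U" "U \<subseteq> X" for U
    proof -
      have "\<exists>W\<subseteq>Y. clopen W \<and> (\<forall>i\<in>I. (U \<inter> B i = {} \<longleftrightarrow> W \<inter> A i = {}) \<and>
           ((X - U) \<inter> B i = {} \<longleftrightarrow> (Y - W) \<inter> A i = {}))"
        by (rule clopen_partition_split[OF I A(1,2)]) (use XY that in \<open>auto simp: P_def\<close>)
      then obtain W where "W \<subseteq> Y" "clopen W" "\<forall>i\<in>I. (U \<inter> B i = {} \<longleftrightarrow> W \<inter> A i = {}) \<and>
           ((X - U) \<inter> B i = {} \<longleftrightarrow> (Y - W) \<inter> A i = {})"
        by (elim exE conjE)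
      then show ?thesis
        using XY that by (intro exI[of _ W]) (simp add: P_def clopen_Diff)
    qed
    show "\<exists>U\<subseteq>X. P U W \<and> P (X - U) (Y - W)" if "clopen W" "W \<subseteq> Y" for W
    proof -
      have "\<exists>U\<subseteq>X. clopen U \<and> (\<forall>i\<in>I. (W \<inter> A i = {} \<longleftrightarrow> U \<inter> B i = {}) \<and>
           ((Y - W) \<inter> A i = {} \<longleftrightarrow> (X - U) \<inter> B i = {}))"
        by (rule clopen_partition_split[OF I B(1,2)]) (use XY that in \<open>auto simp: P_def\<close>)
      then obtain U where "U \<subseteq> X" "clopen U" "\<forall>i\<in>I. (W \<inter> A i = {} \<longleftrightarrow> U \<inter> B i = {}) \<and>
           ((Y - W) \<inter> A i = {} \<longleftrightarrow> (X - U) \<inter> B i = {})"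
        by (elim exE conjE)
      then show ?thesis
        using XY that by (intro exI[of _ U]) (simp add: P_def clopen_Diff)
    qed
  qed (use A B in \<open>auto simp: P_def\<close>)
  then obtain h where h: "h \<in> Homeo" "\<And>U. clopen U \<Longrightarrow> P U (h ` U)"
    by blast
  have "h x \<in> A i \<longleftrightarrow> x \<in> B i" if i: "i \<in> I" for x i
  proof -
    obtain j where j: "j \<in> I" "x \<in> B j"
      using B(4) by blast
    have "h ` B j \<inter> A k = {}" if "k \<in> I" "k \<noteq> j" for k
    proof -
      have "B j \<inter> B k = {}"
        using B(1) that j(1) by (simp add: disjoint_family_on_def)
      then show ?thesis
        using h(2)[OF B(2)[OF j(1)]] that(1) by (simp add: P_def)
    qed
    then have "k = j" if "k \<in> I" "h x \<in> A k" for k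
      using j(2) that by blast
    moreover obtain k where "k \<in> I" "h x \<in> A k"
      using A(4) by blast
    moreover have "x \<in> B i \<Longrightarrow> i = j"
      using B(1) i j by (auto simp: disjoint_family_on_def)
    ultimately show ?thesis
      using i j by metis
  qed
  then show ?thesis
    using h(1) by (intro bexI[of _ h]) auto
qed

text \<open>The values of \<open>N\<close> on the cylinders lie among those of \<open>M\<close> and
  sum to 1, so goodness of \<open>M\<close> realises them by a partition; a homeomorphism carrying
  this partition to the cylinders pushes \<open>M\<close> to the desired measure.\<close>

lemma good_conjugacy_class_approx:
  assumes M: "good M" and N: "N \<in> Full (clopen_values M)"
  shows "\<exists>M'\<in>conjugacy_class M. \<forall>x. measure M' (cyl n x) = measure N (cyl n x)"
proof -
  note MP = goodD(1)[OF M]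
  have NP: "N \<in> Prob" "full N" "clopen_values N \<subseteq> clopen_values M"
    using N by (auto simp: Full_def)
  define I where "I = range (cyl n)"
  have "cyl n x \<noteq> {}" for x
    using in_cyl_self by blast
  then have I: "finite I" "\<And>C. C \<in> I \<Longrightarrow> clopen C" "\<And>C. C \<in> I \<Longrightarrow> C \<noteq> {}"
    using finite_cyls by (auto simp: I_def)
  have disj: "disjoint_family_on (\<lambda>C. C) I"
    unfolding disjoint_family_on_def I_def using disjoint_cyls by blast
  have cover: "(\<Union>C\<in>I. C) = UNIV"
    using in_cyl_self by (auto simp: I_def)
  have "measure M UNIV = (\<Sum>C\<in>I. measure N C)"
    using measure_eq_sum_cyls[OF NP(1), of n UNIV] MP NP(1) by (simp add: I_def)
  moreover have "measure N C \<in> clopen_values M" if "C \<in> I" for C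
    using NP(3) I(2)[OF that] by (auto simp: clopen_values_def)
  ultimately obtain B where B: "\<And>C. C \<in> I \<Longrightarrow> clopen (B C)" "\<And>C. C \<in> I \<Longrightarrow> measure M (B C) = measure N C"
    "disjoint_family_on B I" "(\<Union>C\<in>I. B C) = UNIV"
    using good_clopen_partition[OF M I(1), of "measure N" UNIV] by auto
  \<comment> \<open>Fullness of \<open>N\<close> makes the prescribed values positive.\<close>
  have "B C \<noteq> {}" if "C \<in> I" for C
    using B(2)[OF that] full_null_clopen[OF NP(1,2)] I that by force
  from homeo_clopen_partitions[OF I(1) disj I(2) I(3) cover B(3) B(1) this B(4)]
  obtain h where h: "h \<in> Homeo" "\<forall>C\<in>I. h -` C = B C"
    by (rule bexE)
  have "measure (distr M borel h) (cyl n x) = measure N (cyl n x)" for x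
  proof -
    have "cyl n x \<in> I"
      by (simp add: I_def)
    then show ?thesis
      using distr_Homeo(2)[OF h(1) MP clopen_cyl] h(2) B(2) by simp
  qed
  then show ?thesis
    using h(1) by (auto simp: conjugacy_class_def)
qed

section \<open>The strong and the weak-star topology\<close>

lemma FullD:
  assumes "M \<in> Full V"
  shows "M \<in> Prob" "full M" "clopen U \<Longrightarrow> measure M U \<in> V"
  using assms by (auto simp: Full_def clopen_values_def)

text \<open>As \<open>V\<close> carries the discrete topology, any condition whatsoever on one
  clopen value is open, in particular an inequality \<open>\<le>\<close>.\<close>

lemma openin_strong_Full_value:
  assumes "clopen U"
  shows "openin (strong_Full V) {M \<in> Full V. measure M U \<in> B}"
proof -
  let ?g = "\<lambda>M. \<lambda>U\<in>Collect clopen. measure M U"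
  have "continuous_map (strong_Full V) (discrete_topology V) ((\<lambda>f. f U) \<circ> ?g)"
    unfolding strong_Full_def
    by (intro continuous_map_pullback continuous_map_product_projection) (simp add: assms)
  then have "openin (strong_Full V)
      {M \<in> topspace (strong_Full V). ((\<lambda>f. f U) \<circ> ?g) M \<in> V \<inter> B}"
    by (rule openin_continuous_map_preimage) simp
  moreover have "{M \<in> topspace (strong_Full V). ((\<lambda>f. f U) \<circ> ?g) M \<in> V \<inter> B} = {M \<in> Full V. measure M U \<in> B}"
    using FullD(3) assms by (auto simp: topspace_strong_Full)
  ultimately show ?thesis
    by simp
qed

lemma openin_strong_Full_eq: "clopen U \<Longrightarrow> openin (strong_Full V) {M \<in> Full V. measure M U = v}"
  using openin_strong_Full_value[of U V "{v}"] by simp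

lemma openin_strong_Full_le: "clopen U \<Longrightarrow> openin (strong_Full V) {M \<in> Full V. measure M U \<le> v}"
  using openin_strong_Full_value[of U V "{..v}"] by simp

lemma openin_strong_Full_finite:
  assumes "finite F" "\<And>U. U \<in> F \<Longrightarrow> clopen U"
  shows "openin (strong_Full V) {M \<in> Full V. \<forall>U\<in>F. measure M U = \<phi> U}"
  using assms
proof (induction F)
  case empty
  then show ?case
    using openin_topspace[of "strong_Full V"] by (simp add: topspace_strong_Full)
next
  case (insert U F)
  have "{M \<in> Full V. \<forall>U\<in>insert U F. measure M U = \<phi> U} =
      {M \<in> Full V. measure M U = \<phi> U} \<inter> {M \<in> Full V. \<forall>U\<in>F. measure M U = \<phi> U}"
    by auto
  then show ?case
    using insert openin_strong_Full_eq[of U V "\<phi> U"] by (simp only: openin_Int insertI1 insertI2)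
qed

lemma openin_strong_Full_cyls:
  "openin (strong_Full V) {M \<in> Full V. \<forall>x. measure M (cyl n x) = measure N (cyl n x)}"
proof -
  have "{M \<in> Full V. \<forall>x. measure M (cyl n x) = measure N (cyl n x)} =
      {M \<in> Full V. \<forall>U\<in>range (cyl n). measure M U = measure N U}"
    by auto
  moreover have "openin (strong_Full V) \<dots>"
    by (rule openin_strong_Full_finite[OF finite_cyls]) auto
  ultimately show ?thesis
    by simp
qed

text \<open>A basic open box restricts finitely many clopen sets. They are unions of cylinders of
  one common level, and their measures are sums of cylinder measures, so agreement on a single level
  gives a neighbourhood base.\<close>

lemma openin_strong_Full_iff:
  "openin (strong_Full V) S \<longleftrightarrow> S \<subseteq> Full V \<and>
    (\<forall>M\<in>S. \<exists>n. \<forall>N\<in>Full V. (\<forall>x. measure N (cyl n x) = measure M (cyl n x)) \<longrightarrow> N \<in> S)"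
    (is "_ \<longleftrightarrow> _ \<and> ?R")
proof
  let ?g = "\<lambda>M. \<lambda>U\<in>Collect clopen. measure M U"
  assume S: "openin (strong_Full V) S"
  then obtain T where T: "openin (product_topology (\<lambda>_. discrete_topology V) (Collect clopen)) T"
    "S = ?g -` T \<inter> Full V"
    by (auto simp: strong_Full_def openin_pullback_topology)
  have ?R
  proof
    fix M assume M: "M \<in> S"
    then have "?g M \<in> T"
      using T(2) by blast
    then obtain X where X: "finite {U \<in> Collect clopen. X U \<noteq> V}" "?g M \<in> Pi\<^sub>E (Collect clopen) X"
      "Pi\<^sub>E (Collect clopen) X \<subseteq> T"
      using T(1) unfolding openin_product_topology_alt topspace_discrete_topology by blast
    obtain n where n: "\<And>U x. clopen U \<Longrightarrow> X U \<noteq> V \<Longrightarrow> cyl n x \<subseteq> U \<or> cyl n x \<inter> U = {}"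
      using cyl_family_depends_finite[OF X(1)] by auto
    have "N \<in> S" if N: "N \<in> Full V" "\<forall>x. measure N (cyl n x) = measure M (cyl n x)" for N
    proof -
      have "measure N U \<in> X U" if U: "clopen U" for U
      proof (cases "X U = V")
        case True
        then show ?thesis
          using FullD(3)[OF N(1) U] by simp
      next
        case False
        have "M \<in> Prob"
          using M T(2) FullD(1) by blast
        then have "measure N U = measure M U"
          using measure_eq_sum_cyls[of _ n U] n[OF U False] N(2) FullD(1)[OF N(1)]
          by (auto intro!: sum.cong)
        then show ?thesis
          using X(2) U by (auto simp: PiE_iff)
      qed
      then have "?g N \<in> Pi\<^sub>E (Collect clopen) X"
        by auto
      then show ?thesis
        using X(3) T(2) N(1) by blast
    qed
    then show "\<exists>n. \<forall>N\<in>Full V. (\<forall>x. measure N (cyl n x) = measure M (cyl n x)) \<longrightarrow> N \<in> S"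
      by blast
  qed
  then show "S \<subseteq> Full V \<and> ?R"
    using T(2) by blast
next
  assume R: "S \<subseteq> Full V \<and> ?R"
  show "openin (strong_Full V) S"
  proof (subst openin_subopen, intro ballI)
    fix M assume M: "M \<in> S"
    then obtain n where n: "\<forall>N\<in>Full V. (\<forall>x. measure N (cyl n x) = measure M (cyl n x)) \<longrightarrow> N \<in> S"
      using R by blast
    then show "\<exists>T. openin (strong_Full V) T \<and> M \<in> T \<and> T \<subseteq> S"
      using openin_strong_Full_cyls[of V n M] M R
      by (intro exI[of _ "{N \<in> Full V. \<forall>x. measure N (cyl n x) = measure M (cyl n x)}"]) auto
  qed
qed

section \<open>Polishness of the strong topology\<close>

lemma second_countable_strong_Full:
  assumes "countable V"
  shows "second_countable (strong_Full V)"
proof -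
  \<comment> \<open>Basic sets prescribe finitely many clopen values; as \<open>V\<close> and the
    family of clopen sets are countable, there are countably many prescriptions.\<close>
  define \<B> where "\<B> F = {M \<in> Full V. \<forall>(U, v)\<in>F. measure M U = v}" for F :: "(cantor set \<times> real) set"
  define \<F> where "\<F> = {F. finite F \<and> F \<subseteq> Collect clopen \<times> V}"
  have count: "countable \<F>"
    unfolding \<F>_def using assms countable_clopen by (intro countable_Collect_finite_subset countable_SIGMA)
  have opn: "openin (strong_Full V) (\<B> F)" if "F \<in> \<F>" for F
  proof -
    have F: "finite F" "F \<subseteq> Collect clopen \<times> V"
      using that by (auto simp: \<F>_def)
    show ?thesis
      using F
    proof (induction F)
      case empty
      then show ?case
        using openin_topspace[of "strong_Full V"] by (simp add: topspace_strong_Full \<B>_def)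
    next
      case (insert p F)
      have "\<B> (insert p F) = {M \<in> Full V. measure M (fst p) = snd p} \<inter> \<B> F"
        by (cases p) (auto simp: \<B>_def)
      moreover have "clopen (fst p)"
        using insert.prems by auto
      ultimately show ?case
        using insert openin_strong_Full_eq[of "fst p" V "snd p"] by (simp add: openin_Int)
    qed
  qed
  have base: "\<exists>F\<in>\<F>. M \<in> \<B> F \<and> \<B> F \<subseteq> S" if S: "openin (strong_Full V) S" "M \<in> S" for S M
  proof -
    obtain n where n: "\<And>N. N \<in> Full V \<Longrightarrow> (\<forall>x. measure N (cyl n x) = measure M (cyl n x)) \<Longrightarrow> N \<in> S"
      using S unfolding openin_strong_Full_iff by meson
    have M: "M \<in> Full V"
      using S by (auto simp: openin_strong_Full_iff)
    have "(\<lambda>C. (C, measure M C)) ` range (cyl n) \<in> \<F>"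
      using FullD(3)[OF M] by (auto simp: \<F>_def intro: finite_imageI[OF finite_cyls])
    then show ?thesis
      using M n by (intro bexI[of _ "(\<lambda>C. (C, measure M C)) ` range (cyl n)"]) (auto simp: \<B>_def)
  qed
  show ?thesis
    unfolding second_countable_def
  proof (intro exI[of _ "\<B> ` \<F>"] conjI allI impI)
    show "countable (\<B> ` \<F>)"
      using count by simp
    show "\<forall>T\<in>\<B> ` \<F>. openin (strong_Full V) T"
      using opn by blast
    show "\<exists>T\<in>\<B> ` \<F>. M \<in> T \<and> T \<subseteq> S" if S: "openin (strong_Full V) S \<and> M \<in> S" for S M
    proof -
      obtain F where "F \<in> \<F>" "M \<in> \<B> F" "\<B> F \<subseteq> S"
        using base[of S M] S by auto
      then show ?thesis
        by (intro bexI[of _ "\<B> F"]) auto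
    qed
  qed
qed

text \<open>Evaluation on clopen sets embeds the space in a countable product of discrete spaces.
  Total mass 1, finite additivity and positivity are closed conditions there, and they describe the
  image because such functions extend to measures.\<close>

lemma completely_metrizable_strong_Full:
  "completely_metrizable_space (strong_Full V)"
proof -
  let ?g = "\<lambda>M. \<lambda>U\<in>Collect clopen. measure M U"
  let ?P = "product_topology (\<lambda>_. discrete_topology V) (Collect clopen :: cantor set set)"
  have P: "completely_metrizable_space ?P"
    unfolding completely_metrizable_space_product_topology
    by (auto simp: completely_metrizable_space_discrete_topology intro: countable_subset[OF _ countable_clopen])
  have gP: "?g M \<in> topspace ?P" if "M \<in> Full V" for M
    using FullD(3)[OF that] by auto
  have inj: "inj_on ?g (Full V)"
  proof (rule inj_onI)
    fix M N assume MN: "M \<in> Full V" "N \<in> Full V" "?g M = ?g N"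
    have "measure M U = measure N U" if "clopen U" for U
      using fun_cong[OF MN(3), of U] that by simp
    then show "M = N"
      using Prob_eqI FullD(1) MN by blast
  qed
  have img: "?g ` Full V = {\<phi> \<in> topspace ?P. \<phi> UNIV = 1 \<and> (\<forall>A\<in>Collect clopen. \<forall>B\<in>Collect clopen.
      A \<inter> B = {} \<longrightarrow> \<phi> (A \<union> B) = \<phi> A + \<phi> B) \<and> (\<forall>A\<in>Collect clopen. A \<noteq> {} \<longrightarrow> \<phi> A > 0)}"
    (is "_ = ?I")
  proof (intro equalityI subsetI)
    fix \<phi> assume "\<phi> \<in> ?g ` Full V"
    then obtain M where M: "M \<in> Full V" "\<phi> = ?g M"
      by blast
    then have "\<phi> \<in> topspace ?P"
      using gP by blast
    then show "\<phi> \<in> ?I"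
      using FullD(1,2)[OF M(1)] full_iff[of M] measure_clopen_Un[of M] M(2) by auto
  next
    fix \<phi> assume "\<phi> \<in> ?I"
    then have \<phi>: "\<phi> \<in> (\<Pi>\<^sub>E U\<in>Collect clopen. V)" "\<phi> UNIV = 1"
      "\<And>A B. clopen A \<Longrightarrow> clopen B \<Longrightarrow> A \<inter> B = {} \<Longrightarrow> \<phi> (A \<union> B) = \<phi> A + \<phi> B"
      "\<And>A. clopen A \<Longrightarrow> A \<noteq> {} \<Longrightarrow> \<phi> A > 0"
      by simp_all
    have "\<phi> {} = 0"
      using \<phi>(3)[of "{}" "{}"] by simp
    then have "\<phi> U \<ge> 0" if "clopen U" for U
      using \<phi>(4)[OF that] by (cases "U = {}") simp_all
    then obtain M where M: "M \<in> Prob" "\<And>U. clopen U \<Longrightarrow> measure M U = \<phi> U"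
      using clopen_measure_extension[of \<phi>] \<phi>(2,3) by blast
    have "full M"
      using \<phi>(4) M(2) by (simp add: full_iff[OF M(1)])
    moreover have "clopen_values M \<subseteq> V"
      using \<phi>(1) M(2) by (auto simp: clopen_values_def)
    ultimately have "M \<in> Full V"
      using M(1) by (simp add: Full_def)
    moreover have "\<phi> = ?g M"
    proof
      fix U
      show "\<phi> U = ?g M U"
        using M(2) PiE_arb[OF \<phi>(1), of U] by (cases "clopen U") auto
    qed
    ultimately show "\<phi> \<in> ?g ` Full V"
      by blast
  qed
  have cont: "continuous_map ?P euclideanreal (\<lambda>\<phi>. \<phi> U)" if "clopen U" for U
  proof -
    have "continuous_map ?P (discrete_topology V) (\<lambda>\<phi>. \<phi> U)"
      using that by (intro continuous_map_product_projection) simp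
    moreover have "continuous_map (discrete_topology V) euclideanreal (\<lambda>x. x)"
      by (simp add: continuous_map_from_discrete_topology)
    ultimately show ?thesis
      using continuous_map_compose[of ?P "discrete_topology V" "\<lambda>\<phi>. \<phi> U" euclideanreal "\<lambda>x. x"]
      by (simp add: o_def)
  qed
  have closed_add: "closedin ?P {\<phi> \<in> topspace ?P. \<phi> (A \<union> B) = \<phi> A + \<phi> B}" if "clopen A" "clopen B" for A B
  proof -
    have "closedin ?P {\<phi> \<in> topspace ?P. \<phi> (A \<union> B) - (\<phi> A + \<phi> B) \<in> {0}}"
      using that by (intro closedin_continuous_map_preimage[of _ euclideanreal] continuous_map_diff
          continuous_map_add cont) auto
    then show ?thesis
      by simp
  qed
  \<comment> \<open>A strict inequality is closed here because every subset of the discrete space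
    \<open>V\<close> is closed.\<close>
  have closed_pos: "closedin ?P {\<phi> \<in> topspace ?P. \<phi> A > 0}" if "clopen A" for A
  proof -
    have "closedin ?P {\<phi> \<in> topspace ?P. \<phi> A \<in> V \<inter> {0<..}}"
      using that by (intro closedin_continuous_map_preimage[of _ "discrete_topology V"]
          continuous_map_product_projection) auto
    moreover have "{\<phi> \<in> topspace ?P. \<phi> A \<in> V \<inter> {0<..}} = {\<phi> \<in> topspace ?P. \<phi> A > 0}"
      using that by (auto simp: PiE_iff)
    ultimately show ?thesis
      by simp
  qed
  have closed_one: "closedin ?P {\<phi> \<in> topspace ?P. \<phi> UNIV \<in> {1}}"
    by (intro closedin_continuous_map_preimage[of _ euclideanreal] cont) auto
  \<comment> \<open>Intersections of closed sets need nonempty index families;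
    \<open>insert UNIV\<close> makes this evident and leaves the family as it is,
    \<open>UNIV\<close> being clopen and nonempty.\<close>
  have "?I = {\<phi> \<in> topspace ?P. \<phi> UNIV \<in> {1}} \<inter>
      (\<Inter>(A, B)\<in>{(A, B). clopen A \<and> clopen B \<and> A \<inter> B = {}}. {\<phi> \<in> topspace ?P. \<phi> (A \<union> B) = \<phi> A + \<phi> B}) \<inter>
      (\<Inter>A\<in>insert UNIV {A. clopen A \<and> A \<noteq> {}}. {\<phi> \<in> topspace ?P. \<phi> A > 0})"
    by auto
  moreover have "closedin ?P \<dots>"
  proof (intro closedin_Int closedin_INT closed_one)
    show "{(A, B). clopen A \<and> clopen B \<and> A \<inter> B = {}} \<noteq> {}"
      using clopen_empty by blast
  qed (auto intro: closed_add closed_pos simp del: topspace_product_topology)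
  ultimately have "closedin ?P (?g ` Full V)"
    unfolding img by simp
  then have cm: "completely_metrizable_space (subtopology ?P (?g ` Full V))"
    using P by (simp add: completely_metrizable_space_closedin)
  have "homeomorphic_map (strong_Full V) (subtopology ?P (?g ` Full V)) ?g"
  proof (rule bijective_open_imp_homeomorphic_map)
    show "continuous_map (strong_Full V) (subtopology ?P (?g ` Full V)) ?g"
    proof (rule continuous_map_into_subtopology)
      have "continuous_map (strong_Full V) ?P (id \<circ> ?g)"
        unfolding strong_Full_def by (intro continuous_map_pullback continuous_map_id)
      then show "continuous_map (strong_Full V) ?P ?g"
        by simp
    qed (simp add: topspace_strong_Full)
    show "open_map (strong_Full V) (subtopology ?P (?g ` Full V)) ?g"
      unfolding open_map_def
    proof (intro allI impI)
      fix S assume "openin (strong_Full V) S"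
      then obtain T where T: "openin ?P T" "S = ?g -` T \<inter> Full V"
        by (auto simp: strong_Full_def openin_pullback_topology)
      then have "?g ` S = T \<inter> ?g ` Full V"
        by auto
      then show "openin (subtopology ?P (?g ` Full V)) (?g ` S)"
        using T(1) by (auto simp: openin_subtopology)
    qed
    show "?g ` topspace (strong_Full V) = topspace (subtopology ?P (?g ` Full V))"
      unfolding topspace_strong_Full topspace_subtopology using gP by blast
    show "inj_on ?g (topspace (strong_Full V))"
      using inj by (simp only: topspace_strong_Full)
  qed
  then show ?thesis
    using cm homeomorphic_completely_metrizable_space homeomorphic_map_imp_homeomorphic_space by blast
qed

lemma polish_strong_Full:
  assumes "countable V"
  shows "polish_topology (strong_Full V)"
  unfolding polish_topology_def
  using second_countable_strong_Full[OF assms] completely_metrizable_strong_Full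
  by (simp add: second_countable_imp_separable_space)

section \<open>Comparison of the strong and the weak-star topology\<close>

lemma continuous_map_strong_integral:
  fixes f :: "cantor \<Rightarrow> real"
  assumes f: "continuous_on UNIV f"
  shows "continuous_map (strong_Full V) euclideanreal (\<lambda>M. \<integral>x. f x \<partial>M)"
proof -
  have "continuous_map (strong_Full V) Met_TC.mtopology (\<lambda>M. \<integral>x. f x \<partial>M)"
    unfolding Met_TC.continuous_map_to_metric
  proof (intro ballI allI impI)
    fix M and \<epsilon> :: real assume M: "M \<in> topspace (strong_Full V)" and \<epsilon>: "\<epsilon> > 0"
    then have MV: "M \<in> Full V"
      by (simp add: topspace_strong_Full)
    \<comment> \<open>Radius \<open>\<epsilon> / 6\<close> makes values of \<open>f\<close> on one
      cylinder differ by less than \<open>\<epsilon> / 3\<close>; the approximation errors for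
      \<open>M\<close> and \<open>N\<close> then add up to at most
      \<open>2 * \<epsilon> / 3\<close>, which is below \<epsilon>.\<close>
    have "open (f -` ball c (\<epsilon> / 6))" for c
      using f by (simp add: open_vimage)
    moreover have "x \<in> f -` ball (f x) (\<epsilon> / 6)" for x
      using \<epsilon> by simp
    then have "(\<Union>c. f -` ball c (\<epsilon> / 6)) = UNIV"
      by blast
    ultimately obtain n where n: "\<And>x. \<exists>c. cyl n x \<subseteq> f -` ball c (\<epsilon> / 6)"
      using Lebesgue_number_cyl[of "range (\<lambda>c. f -` ball c (\<epsilon> / 6))"] by auto
    define r where "r C = f (SOME x. x \<in> C)" for C
    have rep: "\<bar>f x - r (cyl n x)\<bar> \<le> \<epsilon> / 3" for x
    proof -
      obtain c where c: "cyl n x \<subseteq> f -` ball c (\<epsilon> / 6)"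
        using n by blast
      have "(SOME y. y \<in> cyl n x) \<in> cyl n x"
        by (rule someI[where P="\<lambda>y. y \<in> cyl n x", OF in_cyl_self])
      then have "(SOME y. y \<in> cyl n x) \<in> f -` ball c (\<epsilon> / 6)" "x \<in> f -` ball c (\<epsilon> / 6)"
        using c in_cyl_self[of x n] by blast+
      then have "dist c (f x) < \<epsilon> / 6" "dist c (r (cyl n x)) < \<epsilon> / 6"
        by (simp_all add: r_def)
      then show ?thesis
        unfolding dist_real_def by linarith
    qed
    have "\<bar>(\<integral>x. f x \<partial>N) - (\<integral>x. f x \<partial>M)\<bar> < \<epsilon>"
      if N: "N \<in> Full V" "\<forall>x. measure N (cyl n x) = measure M (cyl n x)" for N
    proof -
      have "(\<Sum>C\<in>range (cyl n). r C * measure N C) = (\<Sum>C\<in>range (cyl n). r C * measure M C)"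
        using N(2) by (intro sum.cong) auto
      then show ?thesis
        using integral_approx_cyls[OF FullD(1)[OF N(1)] f rep] integral_approx_cyls[OF FullD(1)[OF MV] f rep] \<epsilon>
        by linarith
    qed
    then show "\<exists>U. openin (strong_Full V) U \<and> M \<in> U \<and> (\<forall>N\<in>U. (\<integral>x. f x \<partial>N) \<in> Met_TC.mball (\<integral>x. f x \<partial>M) \<epsilon>)"
      using openin_strong_Full_cyls[of V n M] MV
      by (intro exI[of _ "{N \<in> Full V. \<forall>x. measure N (cyl n x) = measure M (cyl n x)}"])
        (auto simp: dist_real_def abs_minus_commute)
  qed
  then show ?thesis
    by simp
qed

lemma strong_finer_than_weak_star:
  assumes "openin (weak_star_Full V) S"
  shows "openin (strong_Full V) S"
proof -
  let ?F = "{f :: cantor \<Rightarrow> real. continuous_on UNIV f}"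
  have "continuous_map (strong_Full V) weak_star (\<lambda>M. M)"
    unfolding weak_star_def
  proof (rule continuous_map_pullback')
    show "continuous_map (strong_Full V) (product_topology (\<lambda>_. euclideanreal) ?F)
        ((\<lambda>M. \<lambda>f\<in>?F. \<integral>x. f x \<partial>M) \<circ> (\<lambda>M. M))"
      by (auto simp: continuous_map_componentwise continuous_map_strong_integral)
    show "topspace (strong_Full V) \<subseteq> (\<lambda>M. M) -` Prob"
      using FullD(1) by (auto simp: topspace_strong_Full)
  qed
  then have "continuous_map (strong_Full V) (weak_star_Full V) (\<lambda>M. M)"
    unfolding weak_star_Full_def by (rule continuous_map_into_subtopology) (simp add: topspace_strong_Full)
  from openin_continuous_map_preimage[OF this assms]
  have "openin (strong_Full V) {M \<in> Full V. M \<in> S}"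
    by (simp add: topspace_strong_Full)
  moreover have "S \<subseteq> Full V"
    using openin_subset[OF assms] by (simp add: topspace_weak_star_Full)
  ultimately show ?thesis
    by (simp add: Collect_conj_eq Int_absorb1)
qed

section \<open>Closed conditions and Borel classes\<close>

lemma closedin_weak_star_value:
  assumes U: "clopen U" and B: "closed B"
  shows "closedin weak_star {M \<in> Prob. measure M U \<in> B}"
proof -
  let ?F = "{f :: cantor \<Rightarrow> real. continuous_on UNIV f}"
  let ?g = "\<lambda>M. \<lambda>f\<in>?F. \<integral>x. f x \<partial>M"
  \<comment> \<open>Clopen sets have continuous indicators, so clopen values are among the integrals
    that define the weak-star topology.\<close>
  have "(indicator U :: cantor \<Rightarrow> real) -` T = (if 1 \<in> T then U else {}) \<union> (if 0 \<in> T then - U else {})" for T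
    by (auto simp: indicator_def of_bool_def split: if_splits)
  then have ind: "continuous_on UNIV (indicator U :: cantor \<Rightarrow> real)"
    using U by (simp add: continuous_on_open_vimage clopen_def open_Compl open_Un)
  have "continuous_map weak_star euclideanreal ((\<lambda>\<phi>. \<phi> (indicator U)) \<circ> ?g)"
    unfolding weak_star_def
    by (intro continuous_map_pullback continuous_map_product_projection) (simp add: ind)
  then have "closedin weak_star {M \<in> topspace weak_star. ((\<lambda>\<phi>. \<phi> (indicator U)) \<circ> ?g) M \<in> B}"
    by (rule closedin_continuous_map_preimage) (simp add: B)
  moreover have "((\<lambda>\<phi>. \<phi> (indicator U)) \<circ> ?g) M = measure M U" if "M \<in> Prob" for M
    using ind clopen_sets[OF that U] ProbD(3)[OF that] by simp
  then have "{M \<in> topspace weak_star. ((\<lambda>\<phi>. \<phi> (indicator U)) \<circ> ?g) M \<in> B} = {M \<in> Prob. measure M U \<in> B}"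
    by (intro Collect_cong conj_cong) (simp_all only: topspace_weak_star)
  ultimately show ?thesis
    by (simp only:)
qed

lemma closedin_weak_star_eq: "clopen U \<Longrightarrow> closedin weak_star {M \<in> Prob. measure M U = v}"
  using closedin_weak_star_value[of U "{v}"] by simp

lemma closedin_weak_star_le: "clopen U \<Longrightarrow> closedin weak_star {M \<in> Prob. measure M U \<le> v}"
  using closedin_weak_star_value[of U "{..v}"] by simp

lemma fsigma_delta_in_INT:
  assumes "countable I" "\<And>i. i \<in> I \<Longrightarrow> fsigma_in X (A i)"
  shows "fsigma_delta_in X (topspace X \<inter> (\<Inter>i\<in>I. A i))"
  unfolding fsigma_delta_in_def relative_to_def intersection_of_def
  using assms by blast

lemma gdelta_in_INT:
  assumes "countable I" "\<And>i. i \<in> I \<Longrightarrow> openin X (A i)"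
  shows "gdelta_in X (topspace X \<inter> (\<Inter>i\<in>I. A i))"
  unfolding gdelta_in_def relative_to_def intersection_of_def
  using assms by blast

lemma fsigma_in_subtopology_Int:
  assumes "fsigma_in X S"
  shows "fsigma_in (subtopology X T) (T \<inter> S)"
  unfolding fsigma_in_subtopology using assms by blast

text \<open>For each clopen \<open>U\<close> the admissible values form a countable set, and fixing
  one of them is a closed condition. Positivity is absorbed by admitting only positive values when
  \<open>U\<close> is nonempty.\<close>

lemma fsigma_delta_Full:
  assumes V: "countable V"
  shows "fsigma_delta_in weak_star (Full V)"
proof -
  define A where "A U = (\<Union>v\<in>{v \<in> V. U \<noteq> {} \<longrightarrow> v > 0}. {M \<in> Prob. measure M U = v})" for U
  have A: "fsigma_in weak_star (A U)" if "U \<in> Collect clopen" for U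
    unfolding A_def using that V
    by (intro fsigma_in_Union countable_image)
      (auto intro!: closed_imp_fsigma_in closedin_weak_star_eq)
  have "M \<in> Full V \<longleftrightarrow> M \<in> Prob \<and> (\<forall>U. clopen U \<longrightarrow> measure M U \<in> V \<and> (U \<noteq> {} \<longrightarrow> measure M U > 0))" for M
    unfolding Full_def clopen_values_def using full_iff[of M] by blast
  then have "Full V = topspace weak_star \<inter> (\<Inter>U\<in>Collect clopen. A U)"
    by (auto simp: A_def topspace_weak_star)
  then show ?thesis
    using fsigma_delta_in_INT[OF countable_clopen A] by simp
qed

section \<open>Density and Borel class of the conjugacy class\<close>

lemma dense_in_good_strong:
  assumes "good M"
  shows "dense_in (strong_Full (clopen_values M)) (conjugacy_class M)"
proof -
  let ?V = "clopen_values M"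
  have sub: "conjugacy_class M \<subseteq> Full ?V"
    using mem_good_conjugacy_class_iff[OF assms] by blast
  have "N \<in> strong_Full ?V closure_of conjugacy_class M" if N: "N \<in> Full ?V" for N
    unfolding in_closure_of topspace_strong_Full
  proof (intro conjI allI impI N)
    fix T assume T: "N \<in> T \<and> openin (strong_Full ?V) T"
    then obtain n where "\<And>M'. M' \<in> Full ?V \<Longrightarrow> \<forall>x. measure M' (cyl n x) = measure N (cyl n x) \<Longrightarrow> M' \<in> T"
      unfolding openin_strong_Full_iff by meson
    then show "\<exists>M'. M' \<in> conjugacy_class M \<and> M' \<in> T"
      using good_conjugacy_class_approx[OF assms N, of n] sub by blast
  qed
  then show ?thesis
    using sub closure_of_subset_topspace[of "strong_Full ?V" "conjugacy_class M"]
    unfolding dense_in_def topspace_strong_Full by blast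
qed

text \<open>A coarser topology has larger closures.\<close>

lemma dense_in_weak_star_if_strong:
  assumes "dense_in (strong_Full V) S"
  shows "dense_in (weak_star_Full V) S"
proof -
  have "M \<in> weak_star_Full V closure_of S" if "M \<in> Full V" for M
  proof -
    have "M \<in> strong_Full V closure_of S"
      using assms that by (simp add: dense_in_def topspace_strong_Full)
    then show ?thesis
      using strong_finer_than_weak_star
      by (simp add: in_closure_of topspace_strong_Full topspace_weak_star_Full)
  qed
  then show ?thesis
    using assms closure_of_subset_topspace[of "weak_star_Full V" S]
    unfolding dense_in_def topspace_strong_Full topspace_weak_star_Full by blast
qed

text \<open>For fixed \<open>W\<close> and \<open>v\<close> the first alternative is closed, and the
  second is a union of closed sets over the countably many clopen \<open>W'\<close>.\<close>

lemma fsigma_delta_good_conjugacy_class: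
  assumes M: "good M" and V: "clopen_values M = V" "countable V"
  shows "fsigma_delta_in (weak_star_Full V) (conjugacy_class M)"
proof -
  define A where "A W v = Full V \<inter> ({N \<in> Prob. measure N W \<le> v} \<union>
    (\<Union>W'\<in>{W'. clopen W' \<and> W' \<subseteq> W}. {N \<in> Prob. measure N W' = v}))" for W v
  have A_iff: "N \<in> A W v \<longleftrightarrow> N \<in> Full V \<and> (measure N W \<le> v \<or> (\<exists>W'\<subseteq>W. clopen W' \<and> measure N W' = v))" for N W v
    using FullD(1) unfolding A_def by blast
  have "fsigma_in (weak_star_Full V) (A W v)" if "clopen W" for W v
  proof -
    have "countable {W'. clopen W' \<and> W' \<subseteq> W}"
      by (rule countable_subset[OF _ countable_clopen]) auto
    then show ?thesis
      unfolding A_def weak_star_Full_def using that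
      by (intro fsigma_in_subtopology_Int fsigma_in_Un fsigma_in_Union countable_image)
        (auto intro!: closed_imp_fsigma_in closedin_weak_star_eq closedin_weak_star_le)
  qed
  then have "fsigma_delta_in (weak_star_Full V)
      (topspace (weak_star_Full V) \<inter> (\<Inter>(W, v)\<in>Collect clopen \<times> V. A W v))"
    using countable_clopen V(2) by (intro fsigma_delta_in_INT countable_SIGMA) auto
  moreover have "topspace (weak_star_Full V) \<inter> (\<Inter>(W, v)\<in>Collect clopen \<times> V. A W v) = conjugacy_class M"
    by (rule set_eqI) (simp add: A_iff topspace_weak_star_Full mem_good_conjugacy_class_iff[OF M V(1)], blast)
  ultimately show ?thesis
    by simp
qed

text \<open>Both alternatives are open in the strong topology; there are countably many pairs of
  \<open>W\<close> and \<open>v\<close>.\<close>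

lemma gdelta_good_conjugacy_class:
  assumes M: "good M" and V: "clopen_values M = V" "countable V"
  shows "gdelta_in (strong_Full V) (conjugacy_class M)"
proof -
  define A where "A W v = {N \<in> Full V. measure N W \<le> v} \<union>
    (\<Union>W'\<in>{W'. clopen W' \<and> W' \<subseteq> W}. {N \<in> Full V. measure N W' = v})" for W v
  have A_iff: "N \<in> A W v \<longleftrightarrow> N \<in> Full V \<and> (measure N W \<le> v \<or> (\<exists>W'\<subseteq>W. clopen W' \<and> measure N W' = v))" for N W v
    unfolding A_def by blast
  have "openin (strong_Full V) (A W v)" if "clopen W" for W v
    unfolding A_def using that
    by (intro openin_Un openin_Union) (auto intro: openin_strong_Full_eq openin_strong_Full_le)
  then have "gdelta_in (strong_Full V)
      (topspace (strong_Full V) \<inter> (\<Inter>(W, v)\<in>Collect clopen \<times> V. A W v))"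
    using countable_clopen V(2) by (intro gdelta_in_INT countable_SIGMA) auto
  moreover have "topspace (strong_Full V) \<inter> (\<Inter>(W, v)\<in>Collect clopen \<times> V. A W v) = conjugacy_class M"
    by (rule set_eqI) (simp add: A_iff topspace_strong_Full mem_good_conjugacy_class_iff[OF M V(1)], blast)
  ultimately show ?thesis
    by simp
qed

text \<open>Baire's theorem is applied to the open sets of both families together: each contains one
  of the two dense sets and is itself dense. In a nonempty space a dense intersection is
  nonempty.\<close>

lemma dense_gdeltas_meet:
  assumes X: "completely_metrizable_space X" "topspace X \<noteq> {}"
    and S: "dense_in X S" "gdelta_in X S" and T: "dense_in X T" "gdelta_in X T"
  shows "S \<inter> T \<noteq> {}"
proof -
  obtain \<S> where \<S>: "countable \<S>" "\<And>U. U \<in> \<S> \<Longrightarrow> openin X U" "S = topspace X \<inter> \<Inter>\<S>"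
    using S(2) unfolding gdelta_in_def relative_to_def intersection_of_def by auto
  obtain \<T> where \<T>: "countable \<T>" "\<And>U. U \<in> \<T> \<Longrightarrow> openin X U" "T = topspace X \<inter> \<Inter>\<T>"
    using T(2) unfolding gdelta_in_def relative_to_def intersection_of_def by auto
  \<comment> \<open>Including \<open>topspace X\<close> makes the intersection relative to the
    space, also when both families are empty.\<close>
  let ?\<G> = "insert (topspace X) (\<S> \<union> \<T>)"
  have "X closure_of U = topspace X" if "U \<in> ?\<G>" for U
  proof -
    have "S \<subseteq> U \<or> T \<subseteq> U"
      using that \<S>(3) \<T>(3) by blast
    then show ?thesis
      using closure_of_mono[of _ U X] S(1) T(1) closure_of_subset_topspace[of X U]
      unfolding dense_in_def by (metis subset_antisym)
  qed
  then have "X closure_of \<Inter>?\<G> = topspace X"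
    using X(1) \<S> \<T> by (intro Baire_category) auto
  moreover have "\<Inter>?\<G> = S \<inter> T"
    using \<S>(3) \<T>(3) by auto
  ultimately show ?thesis
    using X(2) closure_of_empty by metis
qed

theorem proposition3p7:
  fixes V :: "real set" and \<mu> :: "cantor measure"
  assumes "group_like V"
    and "good \<mu>"
    and "clopen_values \<mu> = V"
  shows "(polish_topology (strong_Full V) \<and>
          (\<forall>S. openin (weak_star_Full V) S \<longrightarrow> openin (strong_Full V) S)) \<and>
         fsigma_delta_in weak_star (Full V) \<and>
         (dense_in (weak_star_Full V) (conjugacy_class \<mu>) \<and>
          fsigma_delta_in (weak_star_Full V) (conjugacy_class \<mu>)) \<and>
         (\<forall>C. C \<in> conjugacy_classes V \<and> dense_in (strong_Full V) C \<and> gdelta_in (strong_Full V) C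
            \<longleftrightarrow> C = conjugacy_class \<mu>)"
proof -
  have V: "countable V"
    using assms(1) by (simp add: group_like_def)
  have dense: "dense_in (strong_Full V) (conjugacy_class \<mu>)"
    using dense_in_good_strong[OF assms(2)] assms(3) by simp
  have gdelta: "gdelta_in (strong_Full V) (conjugacy_class \<mu>)"
    using gdelta_good_conjugacy_class[OF assms(2,3) V] .
  have \<mu>: "\<mu> \<in> Full V"
    using goodD[OF assms(2)] assms(3) by (simp add: Full_def)
  have "C \<in> conjugacy_classes V \<and> dense_in (strong_Full V) C \<and> gdelta_in (strong_Full V) C
            \<longleftrightarrow> C = conjugacy_class \<mu>" for C
  proof
    assume C: "C \<in> conjugacy_classes V \<and> dense_in (strong_Full V) C \<and> gdelta_in (strong_Full V) C"
    then obtain \<nu> where \<nu>: "\<nu> \<in> Full V" "C = conjugacy_class \<nu>"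
      by (auto simp: conjugacy_classes_def)
    \<comment> \<open>Conjugacy classes are orbits, so a common element makes them equal.\<close>
    have "C \<inter> conjugacy_class \<mu> \<noteq> {}"
      using \<mu> C dense gdelta completely_metrizable_strong_Full[of V]
      by (intro dense_gdeltas_meet[of "strong_Full V"]) (auto simp: topspace_strong_Full)
    then show "C = conjugacy_class \<mu>"
      using conjugacy_class_eq FullD(1) \<mu> \<nu> by blast
  qed (use \<mu> dense gdelta in \<open>auto simp: conjugacy_classes_def\<close>)
  then show ?thesis
    using polish_strong_Full[OF V] strong_finer_than_weak_star fsigma_delta_Full[OF V]
      dense_in_weak_star_if_strong[OF dense] fsigma_delta_good_conjugacy_class[OF assms(2,3) V]
    by blast
qed

end
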